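(* Let $q=p^e\ge3$ be a prime power and let $\mathbb U^\flat_{S,\mathcal D}$ be an $\mathrm{SL}(2,q)$-$\flat$-unital. Then every automorphism of $\mathbb U^\flat_{S,\mathcal D}$ fixes the block $[\infty]$.
   Context: Affine $\mathrm{SL}(2,q)$-unital: let $S\le\mathrm{SL}(2,q)$ be a subgroup of order $q+1$, let $\mathfrak P$ be the set of Sylow $p$-subgroups of $\mathrm{SL}(2,q)$, and let $\mathcal D$ be a collection of subsets of $\mathrm{SL}(2,q)$, each containing the identity $\mathbb 1$ and of size $q+1$, such that (Q) for each $D\in\mathcal D$ the set $D^*=\{xy^{-1}\mid x,y\in D,\ x\ne y\}$ has $q(q+1)$ elements, and (P) the sets $S\smallsetminus\{\mathbb 1\}$, $T\smallsetminus\{\mathbb 1\}$ ($T\in\mathfrak P$) and $D^*$ ($D\in\mathcal D$) partition $\mathrm{SL}(2,q)\smallsetminus\{\mathbb 1\}$. $\mathbb U_{S,\mathcal D}$ has point set $\mathrm{SL}(2,q)$, blocks $Sg$, $Tg$ ($T\in\mathfrak P$), $Dg$ ($D\in\mathcal D$), $g\in\mathrm{SL}(2,q)$, incidence containment. The parallelism $\flat$ partitions the short blocks $Tg$ into the $q+1$ classes $\{Tg\mid g\in\mathrm{SL}(2,q)\}$, $T\in\mathfrak P$ (the right cosets of a fixed Sylow $p$-subgroup). The $\mathrm{SL}(2,q)$-$\flat$-unital $\mathbb U^\flat_{S,\mathcal D}$ is the unital (a $2$-$(q^3+1,q+1,1)$ design) obtained by adding for each class of $\flat$ a new point incident with all blocks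 of that class, and a new block $[\infty]$ consisting of these $q+1$ new points. *)

theory Defs
  imports
    "HOL-Analysis.Determinants"
    "HOL-Library.Disjoint_Sets"
    "HOL-Computational_Algebra.Primes"
    "HOL-Algebra.Coset"
begin

definition SL2 :: "('a::{field,finite}^2^2) monoid" where
  "SL2 = \<lparr>carrier = {A. det A = 1}, mult = (**), one = mat 1\<rparr>"

definition sylow_subgroups :: "nat \<Rightarrow> ('g, 'm) monoid_scheme \<Rightarrow> 'g set set" where
  "sylow_subgroups p G =
     {T. subgroup T G \<and> card T = p ^ multiplicity p (card (carrier G))}"

definition quotients :: "('g, 'm) monoid_scheme \<Rightarrow> 'g set \<Rightarrow> 'g set" where
  "quotients G D = {x \<otimes>\<^bsub>G\<^esub> inv\<^bsub>G\<^esub> y | x y. x \<in> D \<and> y \<in> D \<and> x \<noteq> y}"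

text \<open>
  The conditions on \<open>S\<close> and \<open>\<D>\<close> for an affine \<open>SL(2,q)\<close>-unital, \<open>q = CARD('a)\<close> a power of \<open>p\<close>.
  The partition is a partition into an indexed family: distinct members of \<open>\<D>\<close> have
  disjoint sets of quotients.
\<close>

definition affine_SL2_unital ::
    "nat \<Rightarrow> ('a::{field,finite}^2^2) set \<Rightarrow> ('a^2^2) set set \<Rightarrow> bool" where
  "affine_SL2_unital p S \<D> \<longleftrightarrow>
     subgroup S SL2 \<and> card S = CARD('a) + 1 \<and>
     (\<forall>D\<in>\<D>. D \<subseteq> carrier SL2 \<and> \<one>\<^bsub>SL2\<^esub> \<in> D \<and> card D = CARD('a) + 1) \<and>
     (\<forall>D\<in>\<D>. card (quotients SL2 D) = CARD('a) * (CARD('a) + 1)) \<and>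
     (S - {\<one>\<^bsub>SL2\<^esub>}) \<union> (\<Union>T\<in>sylow_subgroups p SL2. T - {\<one>\<^bsub>SL2\<^esub>}) \<union> (\<Union>D\<in>\<D>. quotients SL2 D)
       = carrier SL2 - {\<one>\<^bsub>SL2\<^esub>} \<and>
     disjoint_family_on (\<lambda>T. T - {\<one>\<^bsub>SL2\<^esub>}) (sylow_subgroups p (SL2 :: ('a^2^2) monoid)) \<and>
     disjoint_family_on (quotients SL2) \<D> \<and>
     (\<forall>T\<in>sylow_subgroups p SL2. (S - {\<one>\<^bsub>SL2\<^esub>}) \<inter> (T - {\<one>\<^bsub>SL2\<^esub>}) = {}) \<and>
     (\<forall>D\<in>\<D>. (S - {\<one>\<^bsub>SL2\<^esub>}) \<inter> quotients SL2 D = {}) \<and>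
     (\<forall>T\<in>sylow_subgroups p SL2. \<forall>D\<in>\<D>. (T - {\<one>\<^bsub>SL2\<^esub>}) \<inter> quotients SL2 D = {})"

definition long_blocks ::
    "('a::{field,finite}^2^2) set \<Rightarrow> ('a^2^2) set set \<Rightarrow> ('a^2^2) set set" where
  "long_blocks S \<D> = {B #>\<^bsub>SL2\<^esub> g | B g. B \<in> insert S \<D> \<and> g \<in> carrier SL2}"

definition flat_parallelism :: "nat \<Rightarrow> ('a::{field,finite}^2^2) set set set" where
  "flat_parallelism p = {rcosets\<^bsub>SL2\<^esub> T | T. T \<in> sylow_subgroups p SL2}"

text \<open>A point at infinity is labelled by the parallel class of short blocks it is attached to.\<close>

datatype 'a upoint = Affine "'a^2^2" | Infinite "('a^2^2) set set"

definition flat_points :: "nat \<Rightarrow> 'a::{field,finite} upoint set" where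
  "flat_points p = Affine ` carrier SL2 \<union> Infinite ` flat_parallelism p"

definition block_at_infinity :: "nat \<Rightarrow> 'a::{field,finite} upoint set" where
  "block_at_infinity p = Infinite ` flat_parallelism p"

definition flat_blocks ::
    "nat \<Rightarrow> ('a::{field,finite}^2^2) set \<Rightarrow> ('a^2^2) set set \<Rightarrow> 'a upoint set set" where
  "flat_blocks p S \<D> =
     {Affine ` B | B. B \<in> long_blocks S \<D>} \<union>
     {insert (Infinite c) (Affine ` B) | c B. c \<in> flat_parallelism p \<and> B \<in> c} \<union>
     {block_at_infinity p}"

text \<open>Automorphisms of an incidence structure whose blocks are sets of points.\<close>

definition incidence_automorphism :: "'p set \<Rightarrow> 'p set set \<Rightarrow> ('p \<Rightarrow> 'p) \<Rightarrow> bool" where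
  "incidence_automorphism P \<B> f \<longleftrightarrow> bij_betw f P P \<and> bij_betw ((`) f) \<B> \<B>"

end

theory Submission imports Defs begin

text \<open>
  Right multiplications by \<open>SL(2,q)\<close> fix the block \<open>[\<infinity>]\<close> pointwise and act regularly on the affine points. An
  automorphism fixing \<open>[\<infinity>]\<close> pointwise permutes the right cosets of each Sylow subgroup, and a short
  computation with vectors shows that it is a right multiplication; hence the stabiliser of
  \<open>[\<infinity>]\<close> normalises \<open>SL(2,q)\<close>, and its elements fixing \<open>\<one>\<close> are group automorphisms.

  Suppose that \<open>f\<close> moves \<open>[\<infinity>]\<close>. If the two blocks met, then conjugating right multiplications by \<open>f\<close>
  would yield group automorphisms whose fixed elements form one Sylow subgroup: in odd characteristic
  this is impossible since \<open>-\<one>\<close> is fixed, and in even characteristic two distinct such involutions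
  would both invert \<open>S\<close>. So images of \<open>[\<infinity>]\<close> are equal or disjoint. A translate of some \<open>D\<close> cannot be
  such an image, because the translates \<open>Dd\<inverse>\<close> all contain \<open>\<one>\<close>; so the images of \<open>[\<infinity>]\<close> are \<open>[\<infinity>]\<close> and
  all \<open>Sg\<close>, and the automorphism group is doubly transitive on them.

  In odd characteristic each image \<open>B\<close> has a unique involution fixing it pointwise. It leaves all
  images invariant, and any two of these involutions agree on every third image; as only the identity
  fixes \<open>[\<infinity>]\<close> and an affine point, they all coincide, which is absurd.

  In even characteristic consider, for a pair \<open>C, D\<close> of images, the number of involutions that fix
  a third image \<open>X\<close> pointwise and map \<open>C\<close> to \<open>D\<close>. An involution \<open>t\<close> of \<open>SL(2,q)\<close> swaps \<open>S\<close> and \<open>St\<close> and fixes no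
  image but \<open>[\<infinity>]\<close>, so the value taken at \<open>X = [\<infinity>]\<close> is the only one that is taken an odd number of times.
  By double transitivity the number \<open>w\<close> of involutions in \<open>St\<close> does not depend on \<open>t\<close>. It is odd, and
  counting pairs of involutions gives \<open>w < 3\<close>; so \<open>w = 1\<close>, but there are more involutions than cosets of \<open>S\<close>.
\<close>

subsection \<open>The special linear group\<close>

text \<open>The determinant of the matrix with columns \<open>v\<close> and \<open>w\<close>: the
  alternating form that \<open>SL(2,q)\<close> preserves.\<close>

definition dt :: "'a::field^2 \<Rightarrow> 'a^2 \<Rightarrow> 'a" where
  "dt v w = v$1 * w$2 - v$2 * w$1"

lemma dt_simps [simp]:
  "dt v v = 0" "dt 0 v = 0" "dt v 0 = 0"
  "dt (u + v) w = dt u w + dt v w" "dt u (v + w) = dt u v + dt u w"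
  "dt (u - v) w = dt u w - dt v w" "dt u (v - w) = dt u v - dt u w"
  "dt (c *s v) w = c * dt v w" "dt v (c *s w) = c * dt v w"
  "dt (- v) w = - dt v w" "dt v (- w) = - dt v w"
  by (simp_all add: dt_def algebra_simps)

lemma dt_commute: "dt v w = - dt w v"
  by (simp add: dt_def algebra_simps)

lemma vec2_eq_iff: "(v::'a^2) = w \<longleftrightarrow> v$1 = w$1 \<and> v$2 = w$2"
  by (simp add: vec_eq_iff forall_2)

lemma matrix_vector_mult_2: "(A::'a::comm_ring_1^2^2) *v x = vector [A$1$1 * x$1 + A$1$2 * x$2, A$2$1 * x$1 + A$2$2 * x$2]"
  by (simp add: vec2_eq_iff matrix_vector_mult_def sum_2)

lemma dt_matrix_mult: "dt (A *v v) (A *v w) = det A * dt v w"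
  by (simp add: dt_def matrix_vector_mult_2 det_2 algebra_simps)

text \<open>Cramer's rule with the denominator cleared, so that it also covers dependent
  \<open>v\<close> and \<open>w\<close>.\<close>

lemma dt_expand: "dt v w *s x = dt x w *s v + dt v x *s w"
  by (simp add: vec2_eq_iff dt_def algebra_simps)

lemma dt_eq_0_imp_multiple:
  assumes "dt v w = 0" "v \<noteq> 0"
  obtains c where "w = c *s v"
proof (cases "v$1 = 0")
  case True
  then have "v$2 \<noteq> 0" using assms by (auto simp: vec2_eq_iff)
  with True assms have "w = (w$2 / v$2) *s v"
    by (auto simp: vec2_eq_iff dt_def)
  then show ?thesis by (rule that)
next
  case False
  with assms have "w = (w$1 / v$1) *s v"
    by (auto simp: vec2_eq_iff dt_def field_simps)
  then show ?thesis by (rule that)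
qed

lemma ex_dt_eq_1:
  assumes "v \<noteq> 0"
  obtains w where "dt v w = 1"
proof (cases "v$1 = 0")
  case True
  then have "v$2 \<noteq> 0" using assms by (auto simp: vec2_eq_iff)
  with True have "dt v (vector [- 1 / v$2, 0]) = 1" by (simp add: dt_def)
  then show ?thesis by (rule that)
next
  case False
  then have "dt v (vector [0, 1 / v$1]) = 1" by (simp add: dt_def)
  then show ?thesis by (rule that)
qed

lemma matrix_eq_on_basis:
  fixes A B :: "'a::field^2^2"
  assumes "dt v w \<noteq> 0" "A *v v = B *v v" "A *v w = B *v w"
  shows "A = B"
proof -
  have "A *v x = B *v x" for x
  proof -
    have x: "x = (dt x w / dt v w) *s v + (dt v x / dt v w) *s w"
      using dt_expand[of v w x] assms(1)
      by (simp add: vec2_eq_iff field_simps)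
    show ?thesis
      by (subst (1 2) x)
        (simp add: matrix_vector_right_distrib vector_scalar_commute assms)
  qed
  then show ?thesis by (simp add: matrix_eq)
qed

lemma ex_matrix_basis:
  fixes v w v' w' :: "'a::field^2"
  assumes "dt v w = dt v' w'" "dt v w \<noteq> 0"
  obtains A :: "'a^2^2" where "det A = 1" "A *v v = v'" "A *v w = w'"
proof -
  define d where "d = dt v w"
  \<comment> \<open>Column \<open>j\<close> is the required image of the \<open>j\<close>-th unit
    vector, whose coordinates with respect to \<open>v\<close> and \<open>w\<close> come from
    Cramer's rule.\<close>
  define A :: "'a^2^2" where
    "A = (\<chi> i j. (dt (axis j 1) w * v'$i + dt v (axis j 1) * w'$i) / d)"
  have e: "dt (axis 1 1) w = w$2" "dt (axis 2 1) w = - w$1"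
          "dt v (axis 1 1) = - v$2" "dt v (axis 2 1) = v$1"
    by (simp_all add: dt_def axis_def)
  have A: "A $ i $ j = (dt (axis j 1) w * v'$i + dt v (axis j 1) * w'$i) / d" for i j
    by (simp add: A_def)
  have d: "d \<noteq> 0" "v $ 1 * w $ 2 - v $ 2 * w $ 1 = d"
    using assms by (auto simp: d_def dt_def)
  have 1: "A *v v = v'"
  proof -
    have "(A *v v) $ i = (v $ 1 * w $ 2 - v $ 2 * w $ 1) * v' $ i / d" if "i = 1 \<or> i = 2" for i
      using that by (elim disjE) (simp_all add: matrix_vector_mult_2 A e, simp_all add: divide_simps d(1), simp_all add: algebra_simps)
    then show ?thesis by (simp add: vec2_eq_iff d)
  qed
  have 2: "A *v w = w'"
  proof -
    have "(A *v w) $ i = (v $ 1 * w $ 2 - v $ 2 * w $ 1) * w' $ i / d" if "i = 1 \<or> i = 2" for i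
      using that by (elim disjE) (simp_all add: matrix_vector_mult_2 A e, simp_all add: divide_simps d(1), simp_all add: algebra_simps)
    then show ?thesis by (simp add: vec2_eq_iff d)
  qed
  have "det A * dt v w = dt v w"
    using dt_matrix_mult[of A v w] 1 2 assms by simp
  then have "det A = 1" using assms by simp
  then show ?thesis using 1 2 by (rule that)
qed

section \<open>The group structure of \<open>SL2\<close>\<close>

definition adj :: "'a::field^2^2 \<Rightarrow> 'a^2^2" where
  "adj A = vector [vector [A$2$2, - A$1$2], vector [- A$2$1, A$1$1]]"

lemma mat2_eq_iff: "(A::'a^2^2) = B \<longleftrightarrow> A$1$1 = B$1$1 \<and> A$1$2 = B$1$2 \<and> A$2$1 = B$2$1 \<and> A$2$2 = B$2$2"
  by (auto simp: vec2_eq_iff)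

lemma matrix_mult_2: "((A::'a::comm_ring_1^2^2) ** B) $ i $ j = A$i$1 * B$1$j + A$i$2 * B$2$j"
  by (simp add: matrix_matrix_mult_def sum_2)

lemma mat_1_2: "(mat 1::'a::comm_ring_1^2^2) $ 1 $ 1 = 1" "(mat 1::'a::comm_ring_1^2^2) $ 1 $ 2 = 0"
  "(mat 1::'a::comm_ring_1^2^2) $ 2 $ 1 = 0" "(mat 1::'a::comm_ring_1^2^2) $ 2 $ 2 = 1"
  by (simp_all add: mat_def)

lemma carrier_SL2: "A \<in> carrier SL2 \<longleftrightarrow> det A = 1"
  and mult_SL2 [simp]: "A \<otimes>\<^bsub>SL2\<^esub> B = A ** B"
  and one_SL2 [simp]: "\<one>\<^bsub>SL2\<^esub> = mat 1"
  by (simp_all add: SL2_def)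

lemma adj_SL2:
  assumes "det A = 1" shows "det (adj A) = 1" "adj A ** A = mat 1" "A ** adj A = mat 1"
  using assms by (simp_all add: adj_def mat2_eq_iff matrix_mult_2 mat_1_2 det_2 algebra_simps)

interpretation SL2: group "SL2 :: ('a::{field,finite}^2^2) monoid"
proof (rule groupI)
  fix x :: "'a^2^2" assume "x \<in> carrier SL2"
  then show "\<exists>y\<in>carrier SL2. y \<otimes>\<^bsub>SL2\<^esub> x = \<one>\<^bsub>SL2\<^esub>"
    using adj_SL2[of x] by (auto simp: carrier_SL2)
qed (auto simp: carrier_SL2 det_mul matrix_mul_assoc det_I)

lemma SL2_mult_closed: "A \<in> carrier SL2 \<Longrightarrow> B \<in> carrier SL2 \<Longrightarrow> A ** B \<in> carrier SL2"
  using SL2.m_closed by simp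

lemma SL2_inv_one [simp]: "inv\<^bsub>SL2\<^esub> (mat 1 :: 'a::{field,finite}^2^2) = mat 1"
  using SL2.inv_one by simp

lemma SL2_inv_mult [simp]:
  assumes "A \<in> carrier SL2"
  shows "inv\<^bsub>SL2\<^esub> A ** A = mat 1" "A ** inv\<^bsub>SL2\<^esub> A = mat 1"
  using SL2.l_inv[OF assms] SL2.r_inv[OF assms] by simp_all

lemma SL2_cancel [simp]:
  assumes "A \<in> carrier SL2"
  shows "inv\<^bsub>SL2\<^esub> A ** (A ** B) = B" "A ** (inv\<^bsub>SL2\<^esub> A ** B) = B"
    "(B ** A) ** inv\<^bsub>SL2\<^esub> A = B" "(B ** inv\<^bsub>SL2\<^esub> A) ** A = B"
  using SL2_inv_mult[OF assms] by (simp_all add: matrix_mul_assoc) (simp_all add: matrix_mul_assoc[symmetric])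

lemma SL2_vector_cancel [simp]:
  assumes "A \<in> carrier SL2"
  shows "inv\<^bsub>SL2\<^esub> A *v (A *v x) = x" "A *v (inv\<^bsub>SL2\<^esub> A *v x) = x"
  using SL2_inv_mult[OF assms] by (simp_all add: matrix_vector_mul_assoc)

lemma SL2_mult_vector_eq_iff:
  assumes "A \<in> carrier SL2" shows "A *v x = A *v y \<longleftrightarrow> x = y"
  by (metis SL2_vector_cancel(1) assms)

lemma dt_SL2 [simp]: "A \<in> carrier SL2 \<Longrightarrow> dt (A *v v) (A *v w) = dt v w"
  by (simp add: dt_matrix_mult carrier_SL2)

lemma neg_one_SL2: "mat (- 1) \<in> (carrier SL2 :: ('a::{field,finite}^2^2) set)"
  by (simp add: carrier_SL2 det_2 mat_def)

lemma mat_neg_one_mult [simp]: "mat (- 1) *v (v::'a::comm_ring_1^2) = - v"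
  by (simp add: matrix_vector_mult_2 mat_def vec2_eq_iff)

subsection \<open>Stabilisers of vectors\<close>

text \<open>For nonzero \<open>v\<close> these turn out to be exactly the Sylow
  \<open>p\<close>-subgroups; \<open>stab v\<close> depends only on the line spanned by
  \<open>v\<close>.\<close>

definition stab :: "'a::{field,finite}^2 \<Rightarrow> ('a^2^2) set" where
  "stab v = {A \<in> carrier SL2. A *v v = v}"

lemma subgroup_stab: "subgroup (stab v) SL2"
proof (rule SL2.subgroupI)
  show "stab v \<noteq> {}" using SL2.one_closed by (auto simp: stab_def)
  fix a assume "a \<in> stab v"
  then have a: "a \<in> carrier SL2" "a *v v = v" by (auto simp: stab_def)
  then have "inv\<^bsub>SL2\<^esub> a *v v = v" by (metis SL2_vector_cancel(1))
  then show "inv\<^bsub>SL2\<^esub> a \<in> stab v" using a by (simp add: stab_def)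
  fix b assume "b \<in> stab v"
  then show "a \<otimes>\<^bsub>SL2\<^esub> b \<in> stab v" using a
    by (auto simp: stab_def matrix_vector_mul_assoc[symmetric] SL2_mult_closed)
qed (auto simp: stab_def)

text \<open>A right coset of \<open>stab v\<close> amounts to a vector, namely
  \<open>g^-1 v\<close>. This turns questions about short blocks into linear algebra.\<close>

lemma mem_stab_coset_iff:
  assumes "g \<in> carrier SL2" "h \<in> carrier SL2"
  shows "h \<in> stab v #>\<^bsub>SL2\<^esub> g \<longleftrightarrow> inv\<^bsub>SL2\<^esub> h *v v = inv\<^bsub>SL2\<^esub> g *v v"
proof
  assume "h \<in> stab v #>\<^bsub>SL2\<^esub> g"
  then obtain t where t: "t \<in> stab v" "h = t ** g" by (auto simp: r_coset_def)
  then have tc: "t \<in> carrier SL2" "t *v v = v" by (auto simp: stab_def)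
  have "inv\<^bsub>SL2\<^esub> h = inv\<^bsub>SL2\<^esub> g ** inv\<^bsub>SL2\<^esub> t"
    using SL2.inv_mult_group[OF tc(1) assms(1)] t by simp
  moreover have "inv\<^bsub>SL2\<^esub> t *v v = v" using tc by (metis SL2_vector_cancel(1))
  ultimately show "inv\<^bsub>SL2\<^esub> h *v v = inv\<^bsub>SL2\<^esub> g *v v"
    by (simp add: matrix_vector_mul_assoc[symmetric])
next
  assume eq: "inv\<^bsub>SL2\<^esub> h *v v = inv\<^bsub>SL2\<^esub> g *v v"
  have "(h ** inv\<^bsub>SL2\<^esub> g) *v v = v"
    using assms by (simp add: matrix_vector_mul_assoc[symmetric] eq[symmetric])
  then have "h ** inv\<^bsub>SL2\<^esub> g \<in> stab v" using assms by (simp add: stab_def SL2_mult_closed)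
  then show "h \<in> stab v #>\<^bsub>SL2\<^esub> g"
    using assms by (force simp: r_coset_def)
qed

text \<open>The solutions form a translate of the line spanned by \<open>v\<close>.\<close>

lemma card_dt_eq_1:
  assumes "v \<noteq> (0::'a::{field,finite}^2)"
  shows "card {w. dt v w = 1} = CARD('a)"
proof -
  obtain w0 where w0: "dt v w0 = 1" by (rule ex_dt_eq_1[OF assms])
  have "bij_betw (\<lambda>c. w0 + c *s v) UNIV {w. dt v w = 1}"
  proof (rule bij_betwI')
    fix c d show "(w0 + c *s v = w0 + d *s v) = (c = d)"
      using assms by (auto simp: vec2_eq_iff)
  next
    fix w assume "w \<in> {w. dt v w = 1}"
    then have "dt v (w - w0) = 0" using w0 by simp
    then obtain c where "w - w0 = c *s v" using dt_eq_0_imp_multiple assms by blast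
    then show "\<exists>c\<in>UNIV. w = w0 + c *s v" by (metis UNIV_I add.commute diff_add_cancel)
  qed (use w0 in auto)
  then show ?thesis by (metis bij_betw_same_card)
qed

lemma bij_betw_stab:
  assumes "dt v w = 1"
  shows "bij_betw (\<lambda>A. A *v w) (stab v) {w. dt v w = 1}"
proof (rule bij_betwI')
  fix A B assume AB: "A \<in> stab v" "B \<in> stab v"
  show "(A *v w = B *v w) = (A = B)"
    using matrix_eq_on_basis[of v w A B] AB assms by (auto simp: stab_def)
next
  fix A assume "A \<in> stab v"
  then show "A *v w \<in> {w. dt v w = 1}" using assms dt_SL2[of A v w] by (simp add: stab_def)
next
  fix w' assume "w' \<in> {w. dt v w = 1}"
  then show "\<exists>A\<in>stab v. w' = A *v w"
    using ex_matrix_basis[of v w v w'] assms by (auto simp: stab_def carrier_SL2)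
qed

lemma card_stab:
  assumes "v \<noteq> (0::'a::{field,finite}^2)" shows "card (stab v) = CARD('a)"
proof -
  obtain w where "dt v w = 1" by (rule ex_dt_eq_1[OF assms])
  then show ?thesis using bij_betw_same_card[OF bij_betw_stab] card_dt_eq_1[OF assms] by metis
qed

text \<open>Counts the ordered bases \<open>v\<close>, \<open>w\<close> with
  \<open>dt v w = 1\<close>: \<open>v\<close> is any nonzero vector, and then \<open>w\<close> has
  \<open>q\<close> choices.\<close>

lemma card_SL2: "card (carrier SL2 :: ('a::{field,finite}^2^2) set) = CARD('a) * (CARD('a)^2 - 1)"
proof -
  let ?e1 = "axis 1 1 :: 'a^2" and ?e2 = "axis 2 1 :: 'a^2"
  have e: "dt ?e1 ?e2 = 1" by (simp add: dt_def axis_def)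
  have "bij_betw (\<lambda>A. (A *v ?e1, A *v ?e2)) (carrier SL2) (SIGMA v:UNIV - {0}. {w. dt v w = 1})"
  proof (rule bij_betwI')
    fix A B assume "A \<in> (carrier SL2 :: ('a^2^2) set)" "B \<in> (carrier SL2 :: ('a^2^2) set)"
    show "((A *v ?e1, A *v ?e2) = (B *v ?e1, B *v ?e2)) = (A = B)"
      using matrix_eq_on_basis[of ?e1 ?e2 A B] e by auto
  next
    fix A assume "A \<in> (carrier SL2 :: ('a^2^2) set)"
    then have "dt (A *v ?e1) (A *v ?e2) = 1" using e by simp
    moreover from this have "A *v ?e1 \<noteq> 0" by force
    ultimately show "(A *v ?e1, A *v ?e2) \<in> (SIGMA v:UNIV - {0}. {w. dt v w = 1})" by simp
  next
    fix y assume "y \<in> (SIGMA v:UNIV - {0::'a^2}. {w. dt v w = 1})"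
    then have "dt ?e1 ?e2 = dt (fst y) (snd y)" "dt ?e1 ?e2 \<noteq> 0" using e by auto
    then obtain A :: "'a^2^2" where "det A = 1" "A *v ?e1 = fst y" "A *v ?e2 = snd y"
      by (rule ex_matrix_basis)
    then show "\<exists>A\<in>carrier SL2. y = (A *v ?e1, A *v ?e2)"
      by (intro bexI[of _ A]) (simp_all add: carrier_SL2)
  qed
  then have "card (carrier SL2 :: ('a^2^2) set) = card (SIGMA v:UNIV - {0::'a^2}. {w. dt v w = 1})"
    by (rule bij_betw_same_card)
  also have "\<dots> = (\<Sum>v\<in>UNIV - {0::'a^2}. card {w. dt v w = 1})"
    by (rule card_SigmaI) auto
  also have "\<dots> = (\<Sum>v\<in>UNIV - {0::'a^2}. CARD('a))"
    by (rule sum.cong) (auto simp: card_dt_eq_1)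
  finally show ?thesis by (simp add: card_Diff_singleton)
qed

section \<open>Sylow subgroups as stabilisers of vectors\<close>

lemma stab_sylow:
  assumes "prime p" "CARD('a::{field,finite}) = p ^ e" "v \<noteq> (0::'a^2)"
  shows "stab v \<in> sylow_subgroups p SL2"
proof -
  have "CARD('a) \<ge> 2" using card_mono[of "UNIV::'a set" "{0,1}"] by simp
  then have e: "e > 0" using assms by (cases e) auto
  have "\<not> p dvd CARD('a)^2 - 1"
  proof
    assume "p dvd CARD('a)^2 - 1"
    moreover have "p dvd CARD('a)^2" using assms e by (simp add: prime_dvd_power_iff)
    ultimately have "p dvd CARD('a)^2 - (CARD('a)^2 - 1)" by (rule dvd_diff_nat[rotated])
    moreover have "CARD('a)^2 - (CARD('a)^2 - 1) = 1" by (simp add: power2_eq_square)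
    ultimately show False using assms by simp
  qed
  moreover have "CARD('a)^2 - 1 \<noteq> 0" using \<open>CARD('a) \<ge> 2\<close>
    by (metis calculation dvd_0_right)
  ultimately have "multiplicity p (card (carrier (SL2::('a^2^2) monoid))) = e"
    using assms(1) unfolding card_SL2 assms(2)
    by (subst prime_elem_multiplicity_mult_distrib)
      (auto simp: not_dvd_imp_multiplicity_0 prime_gt_0_nat multiplicity_same_power)
  then show ?thesis
    using assms subgroup_stab[of v] card_stab[OF assms(3)] by (simp add: sylow_subgroups_def)
qed

text \<open>By \<open>triv\<close> the group \<open>T\<close> acts freely on the nonzero vectors, so
  its orbits all have \<open>card T\<close> elements and partition a set of size
  \<open>q^2 - 1\<close>.\<close>

lemma subgroup_disjoint_stab_dvd:
  fixes T :: "('a::{field,finite}^2^2) set"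
  assumes T: "subgroup T SL2" and triv: "\<And>v. v \<noteq> 0 \<Longrightarrow> T \<inter> stab v = {mat 1}"
  shows "card T dvd CARD('a)^2 - 1"
proof -
  define orb where "orb v = (\<lambda>t. t *v v) ` T" for v :: "'a^2"
  let ?C = "orb ` (UNIV - {0})"
  have TG: "T \<subseteq> carrier SL2" using T subgroup.subset by blast
  have card_orb: "card (orb v) = card T" if "v \<noteq> 0" for v
    unfolding orb_def
  proof (rule card_image, rule inj_onI)
    fix s t assume st: "s \<in> T" "t \<in> T" "s *v v = t *v v"
    then have "inv\<^bsub>SL2\<^esub> s ** t \<in> T"
      using subgroup.m_closed[OF T] subgroup.m_inv_closed[OF T] by fastforce
    moreover have "(inv\<^bsub>SL2\<^esub> s ** t) *v v = v"
      using st TG by (auto simp: matrix_vector_mul_assoc[symmetric] st(3)[symmetric])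
    ultimately have "inv\<^bsub>SL2\<^esub> s ** t = mat 1" using triv[OF that] TG by (auto simp: stab_def)
    then have "s ** (inv\<^bsub>SL2\<^esub> s ** t) = s ** mat 1" by simp
    then show "s = t" using st TG by (auto simp: subset_iff)
  qed
  have orb_eq: "orb w = orb v" if w: "w \<in> orb v" for v w
  proof -
    from w obtain s where s: "s \<in> T" "w = s *v v" by (auto simp: orb_def)
    have sc: "s \<in> carrier SL2" using s TG by auto
    show ?thesis
    proof (intro equalityI subsetI)
      fix x assume "x \<in> orb w"
      then obtain t where "t \<in> T" "x = t *v w" by (auto simp: orb_def)
      then show "x \<in> orb v" using s subgroup.m_closed[OF T, of t s]
        by (auto simp: orb_def matrix_vector_mul_assoc)
    next
      fix x assume "x \<in> orb v"
      then obtain t where t: "t \<in> T" "x = t *v v" by (auto simp: orb_def)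
      have "t ** inv\<^bsub>SL2\<^esub> s \<in> T" 
        using subgroup.m_closed[OF T t(1) subgroup.m_inv_closed[OF T s(1)]] by simp
      moreover have "x = (t ** inv\<^bsub>SL2\<^esub> s) *v w"
        using t s sc by (simp add: matrix_vector_mul_assoc[symmetric])
      ultimately show "x \<in> orb w" by (auto simp: orb_def)
    qed
  qed
  have "mat 1 \<in> T" using subgroup.one_closed[OF T] by simp
  then have self: "v \<in> orb v" for v by (force simp: orb_def)
  have nz: "t *v v \<noteq> 0" if "t \<in> T" "v \<noteq> 0" for t v
    using that TG SL2_vector_cancel(1)[of t v] by (metis matrix_vector_mult_0_right subsetD)
  have Un: "\<Union>?C = UNIV - {0}"
    using self nz by (auto simp: orb_def image_iff)
  have "card T * card ?C = card (\<Union>?C)"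
  proof (rule card_partition)
    fix c1 c2 assume "c1 \<in> ?C" "c2 \<in> ?C" "c1 \<noteq> c2"
    then show "c1 \<inter> c2 = {}" using orb_eq by blast
  qed (use card_orb in auto)
  then show ?thesis unfolding Un by (simp add: card_Diff_singleton) (metis dvd_triv_left)
qed

text \<open>As \<open>T\<close> has \<open>q\<close> elements and \<open>q\<close> does not divide
  \<open>q^2 - 1\<close>, some nontrivial element of \<open>T\<close> fixes a nonzero vector. The
  disjointness \<open>disj\<close>, a part of condition (P), then forces \<open>T\<close> to be the
  stabiliser of that vector.\<close>

lemma sylow_subgroup_is_stab:
  fixes T :: "('a::{field,finite}^2^2) set"
  assumes p: "prime p" "CARD('a) = p ^ e"
    and disj: "disjoint_family_on (\<lambda>T. T - {\<one>\<^bsub>SL2\<^esub>}) (sylow_subgroups p (SL2 :: ('a^2^2) monoid))"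
    and T: "T \<in> sylow_subgroups p SL2"
  obtains v where "v \<noteq> 0" "T = stab v"
proof -
  have cT: "card T = CARD('a)" and sT: "subgroup T SL2"
    using T stab_sylow[OF p, of "axis 1 1"] card_stab[of "axis 1 1 :: 'a^2"]
    by (auto simp: sylow_subgroups_def)
  have one: "mat 1 \<in> T" "mat 1 \<in> stab v" for v
    using subgroup.one_closed[OF sT] subgroup.one_closed[OF subgroup_stab] by auto
  have c2: "CARD('a) \<ge> 2" using card_mono[of "UNIV::'a set" "{0,1}"] by simp
  have "\<not> CARD('a) dvd CARD('a)^2 - 1"
  proof
    assume "CARD('a) dvd CARD('a)^2 - 1"
    moreover have "CARD('a) dvd CARD('a)^2" by (simp add: power2_eq_square)
    ultimately have "CARD('a) dvd CARD('a)^2 - (CARD('a)^2 - 1)" by (rule dvd_diff_nat[rotated])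
    moreover have "CARD('a)^2 - (CARD('a)^2 - 1) = 1" by (simp add: power2_eq_square)
    ultimately show False using c2 by simp
  qed
  then obtain v where v: "v \<noteq> 0" "T \<inter> stab v \<noteq> {mat 1}"
    using subgroup_disjoint_stab_dvd[OF sT] cT by auto
  have "T = stab v"
  proof (rule ccontr)
    assume "T \<noteq> stab v"
    then have "(T - {mat 1}) \<inter> (stab v - {mat 1}) = {}"
      using disj T stab_sylow[OF p v(1)] by (auto simp: disjoint_family_on_def)
    then show False using v one by auto
  qed
  then show ?thesis using that v by blast
qed

text \<open>For \<open>F h = (f (h\<inverse>))\<inverse>\<close> the hypothesis \<open>Fv\<close> says that \<open>f\<close> permutes the right cosets of each
  \<^term>\<open>stab v\<close>.\<close>

lemma SL2_rigidity:
  fixes F :: "'a::{field,finite}^2^2 \<Rightarrow> 'a^2^2"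
  assumes q: "CARD('a) \<ge> 3"
    and F: "\<And>g. g \<in> carrier SL2 \<Longrightarrow> F g \<in> carrier SL2"
    and F1: "F (mat 1) = mat 1"
    and Fv: "\<And>g h v. g \<in> carrier SL2 \<Longrightarrow> h \<in> carrier SL2 \<Longrightarrow> v \<noteq> 0 \<Longrightarrow>
                F g *v v = F h *v v \<longleftrightarrow> g *v v = h *v v"
    and h: "h \<in> carrier SL2"
  shows "F h = h"
proof -
  have one: "mat 1 \<in> (carrier SL2 :: ('a^2^2) set)" using SL2.one_closed by simp
  have Fid: "F g *v v = v" if "g \<in> carrier SL2" "v \<noteq> 0" "g *v v = v" for g v
    using Fv[OF that(1) one that(2)] that(3) F1 by simp
  \<comment> \<open>\<open>h1\<close> and \<open>h2\<close> agree with \<open>g\<close> on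
    \<open>v\<close>, \<open>h1\<close> fixes \<open>w\<close>, and \<open>h3\<close> fixes
    \<open>u\<close> and agrees with \<open>h2\<close> on \<open>w\<close>. As \<open>dt\<close> is
    preserved, \<open>F g v\<close> has \<open>dt\<close> equal to 1 with \<open>w\<close> and with
    some \<open>w + s u\<close>, where \<open>s\<close> is nonzero; hence it is a multiple of
    \<open>u\<close>, and then \<open>u\<close> itself.\<close>
  have A: "F g *v v = u"
    if g: "g \<in> carrier SL2" and gv: "g *v v = u" and w: "dt v w = 1" "dt u w = 1" for g u v w
  proof -
    have nz: "v \<noteq> 0" "u \<noteq> 0" "w \<noteq> 0" using w by auto
    obtain h1 where h1: "h1 \<in> carrier SL2" "h1 *v v = u" "h1 *v w = w"
      using ex_matrix_basis[of v w u w] w by (auto simp: carrier_SL2)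
    have d2: "dt u (w + u) = 1" using w by simp
    obtain h2 where h2: "h2 \<in> carrier SL2" "h2 *v v = u" "h2 *v w = w + u"
      using ex_matrix_basis[of v w u "w + u"] w d2 by (auto simp: carrier_SL2)
    obtain h3 where h3: "h3 \<in> carrier SL2" "h3 *v u = u" "h3 *v w = w + u"
      using ex_matrix_basis[of u w u "w + u"] w d2 by (auto simp: carrier_SL2)
    have a: "F h1 *v w = w" "F h3 *v u = u" using Fid h1 h3 nz by auto
    have b: "F h1 *v v = F g *v v" "F h2 *v v = F g *v v" "F h3 *v w = F h2 *v w"
      using Fv h1 h2 h3 g gv nz by auto
    define u' where "u' = F g *v v"
    define y where "y = F h2 *v w"
    have "dt u y = dt u w" using dt_SL2[OF F[OF h3(1)], of u w] a b by (simp add: y_def)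
    then have "dt u (y - w) = 0" by simp
    then obtain s where s: "y - w = s *s u" using dt_eq_0_imp_multiple nz by blast
    have "y \<noteq> w"
      using Fv[OF h2(1) one nz(3)] h2 F1 nz by (auto simp: y_def)
    then have "s \<noteq> 0" using s by auto
    have "dt u' w = 1" using dt_SL2[OF F[OF h1(1)], of v w] a b w by (simp add: u'_def)
    moreover have "dt u' y = 1" using dt_SL2[OF F[OF h2(1)], of v w] b w by (simp add: u'_def y_def)
    moreover have "y = w + s *s u" using s by (simp add: algebra_simps)
    ultimately have "dt u' u = 0" using \<open>s \<noteq> 0\<close> by simp
    then have "dt u u' = 0" by (metis dt_commute neg_equal_0_iff_equal)
    then obtain c where c: "u' = c *s u" using dt_eq_0_imp_multiple nz by blast
    then have "c = 1" using \<open>dt u' w = 1\<close> w by simp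
    then show ?thesis using c by (simp add: u'_def)
  qed
  have B: "F g *v v = g *v v" if g: "g \<in> carrier SL2" and nz: "dt v (g *v v) \<noteq> 0" for g v
  proof -
    \<comment> \<open>This multiple of \<open>v - g v\<close> has \<open>dt\<close> equal to 1 with
      both \<open>v\<close> and \<open>g v\<close>.\<close>
    let ?w = "(- 1 / dt v (g *v v)) *s (v - g *v v)"
    show ?thesis by (rule A[OF g refl, where w = ?w]) (use nz in \<open>auto simp: dt_commute[of "g *v v" v]\<close>)
  qed
  have nonscalar: "F h = h" if h: "h \<in> carrier SL2" and False: "\<not> (h = mat 1 \<or> h = mat (- 1))" for h
  proof -
    let ?e1 = "axis 1 1 :: 'a^2" and ?e2 = "axis 2 1 :: 'a^2"
    have "{0, 1::'a} \<noteq> UNIV"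
    proof
      assume "{0, 1::'a} = UNIV"
      then have "CARD('a) = card {0, 1::'a}" by simp
      then show False using q by simp
    qed
    \<comment> \<open>The bound \<open>q >= 3\<close> provides a scalar other than 0 and 1 for the
      test vectors below.\<close>
    then obtain k :: 'a where k: "k \<noteq> 0" "k \<noteq> 1" by auto
    define c b m where "c = h$2$1" and "b = h$1$2" and "m = h$2$2 - h$1$1"
    \<comment> \<open>This quadratic form vanishes at a nonzero vector exactly if that is an
      eigenvector of \<open>h\<close>. By \<open>B\<close> it suffices to find two independent
      vectors at which it does not vanish.\<close>
    have Q: "dt (x *s ?e1 + y *s ?e2) (h *v (x *s ?e1 + y *s ?e2)) = c * x^2 + m * x * y - b * y^2" for x y
      by (simp add: dt_def axis_def matrix_vector_mult_2 c_def b_def m_def algebra_simps power2_eq_square)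
    have e: "dt (x *s ?e1 + y *s ?e2) (x' *s ?e1 + y' *s ?e2) = x * y' - y * x'" for x y x' y'
      by (simp add: dt_def axis_def)
    have nz: "\<not> (c = 0 \<and> b = 0 \<and> m = 0)"
    proof
      assume "c = 0 \<and> b = 0 \<and> m = 0"
      then have hh: "h$2$1 = 0" "h$1$2 = 0" "h$2$2 = h$1$1" by (auto simp: c_def b_def m_def)
      then have "h$1$1 * h$1$1 = 1" using h by (simp add: carrier_SL2 det_2)
      then have "h$1$1 = 1 \<or> h$1$1 = - 1" by (simp add: square_eq_1_iff)
      then show False using hh False by (auto simp: mat2_eq_iff mat_def)
    qed
    have pair: "F h = h"
      if "c * x^2 + m * x * y - b * y^2 \<noteq> 0" "c * x'^2 + m * x' * y' - b * y'^2 \<noteq> 0" "x * y' - y * x' \<noteq> 0"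
      for x y x' y'
      using matrix_eq_on_basis[OF that(3)[folded e], of "F h" h] B[OF h that(1)[folded Q]] B[OF h that(2)[folded Q]] by simp
    consider "c \<noteq> 0" "b \<noteq> 0" | "c = 0" "b = 0" | "c \<noteq> 0" "b = 0" | "c = 0" "b \<noteq> 0" by blast
    then show ?thesis
    proof cases
      case 1
      then show ?thesis using pair[of 1 0 0 1] by simp
    next
      case 2
      then have "m \<noteq> 0" using nz by simp
      then show ?thesis using pair[of 1 1 1 k] 2 k by simp
    next
      case 3
      show ?thesis
      proof (cases "c + m = 0")
        case True
        then have "c + m * k = c * (1 - k)" by algebra
        then have "c + m * k \<noteq> 0" using 3 k by simp
        then show ?thesis using pair[of 1 0 1 k] 3 k by simp
      qed (use pair[of 1 0 1 1] 3 in simp)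
    next
      case 4
      show ?thesis
      proof (cases "m = b")
        case True
        then have "m * k - b * k^2 = b * k * (1 - k)" by (simp add: algebra_simps power2_eq_square)
        then have "m * k - b * k^2 \<noteq> 0" using 4 k by simp
        then show ?thesis using pair[of 0 1 1 k] 4 k by simp
      qed (use pair[of 0 1 1 1] 4 in simp)
    qed
  qed
  show ?thesis
  proof (cases "h = mat (- 1) \<and> F h \<noteq> mat (- 1)")
    case True
    \<comment> \<open>\<open>F h\<close> is the identity or nonscalar, so \<open>F\<close> fixes it.
      The equivalence \<open>Fv\<close> for the matrices \<open>F h\<close> and \<open>h\<close>
      then yields \<open>F h = h\<close>.\<close>
    then have "F (F h) = F h" using nonscalar[OF F[OF h]] F1 by (cases "F h = mat 1") auto
    then have "F h *v v = h *v v" if "v \<noteq> 0" for v using Fv[OF F[OF h] h that] by simp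
    then have "F h *v v = h *v v" for v by (cases "v = 0") auto
    then show ?thesis by (simp add: matrix_eq)
  qed (use nonscalar[OF h] F1 in auto)
qed

subsection \<open>Points and blocks\<close>

locale flat_unital =
  fixes p e :: nat
    and S :: "('a::{field,finite}^2^2) set"
    and \<D> :: "('a^2^2) set set"
  assumes prime: "prime p" and card_field: "CARD('a) = p ^ e" and card_ge_3: "CARD('a) \<ge> 3"
    and affine_unital: "affine_SL2_unital p S \<D>"
begin

abbreviation finv :: "('b \<Rightarrow> 'b) \<Rightarrow> 'b \<Rightarrow> 'b" where "finv f \<equiv> inv_into UNIV f"
abbreviation G :: "('a^2^2) set" where "G \<equiv> carrier SL2"
abbreviation Inft :: "'a upoint set" where "Inft \<equiv> block_at_infinity p"
abbreviation blocks :: "'a upoint set set" where "blocks \<equiv> flat_blocks p S \<D>"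

definition pt :: "'a^2 \<Rightarrow> 'a upoint" where
  "pt v = Infinite (rcosets\<^bsub>SL2\<^esub> (stab v))"

definition sblock :: "'a^2 \<Rightarrow> 'a^2^2 \<Rightarrow> 'a upoint set" where
  "sblock v g = insert (pt v) (Affine ` (stab v #>\<^bsub>SL2\<^esub> g))"

lemma one_G [simp]: "mat 1 \<in> G" using SL2.one_closed by simp

lemma subgroup_S: "subgroup S SL2"
  and card_S: "card S = CARD('a) + 1"
  and D_subset: "D \<in> \<D> \<Longrightarrow> D \<subseteq> G"
  and one_D: "D \<in> \<D> \<Longrightarrow> mat 1 \<in> D"
  and card_D: "D \<in> \<D> \<Longrightarrow> card D = CARD('a) + 1"
  and card_quotients: "D \<in> \<D> \<Longrightarrow> card (quotients SL2 D) = CARD('a) * (CARD('a) + 1)"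
  and sylow_disjoint: "disjoint_family_on (\<lambda>T. T - {\<one>\<^bsub>SL2\<^esub>}) (sylow_subgroups p (SL2 :: ('a^2^2) monoid))"
  and covering: "(S - {mat 1}) \<union> (\<Union>T\<in>sylow_subgroups p SL2. T - {mat 1}) \<union> (\<Union>D\<in>\<D>. quotients SL2 D)
       = carrier SL2 - {mat 1}"
  and S_sylow: "T \<in> sylow_subgroups p SL2 \<Longrightarrow> (S - {mat 1}) \<inter> (T - {mat 1}) = {}"
  using affine_unital unfolding affine_SL2_unital_def one_SL2
  by (elim conjE, (assumption | meson)?)+

lemma S_subset: "S \<subseteq> G" and one_S [simp]: "mat 1 \<in> S"
  using subgroup.subset[OF subgroup_S] subgroup.one_closed[OF subgroup_S] by auto

lemma sylow_subgroups_eq: "sylow_subgroups p SL2 = stab ` (UNIV - {0 :: 'a^2})"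
  using stab_sylow[OF prime card_field] sylow_subgroup_is_stab[OF prime card_field sylow_disjoint]
  by (intro equalityI subsetI) (metis DiffI UNIV_I image_eqI singletonD, auto)

lemma S_inter_stab: "v \<noteq> 0 \<Longrightarrow> s \<in> S \<Longrightarrow> s \<in> stab v \<Longrightarrow> s = mat 1"
  using S_sylow[of "stab v"] by (auto simp: sylow_subgroups_eq)

lemma Inft_eq: "Inft = pt ` (UNIV - {0})"
  by (auto simp: block_at_infinity_def flat_parallelism_def sylow_subgroups_eq pt_def)

lemma stab_subset: "stab v \<subseteq> G" and one_stab [simp]: "mat 1 \<in> stab v"
  by (auto simp: stab_def)

lemma rcoset_subset: "B \<subseteq> G \<Longrightarrow> g \<in> G \<Longrightarrow> B #>\<^bsub>SL2\<^esub> g \<subseteq> G"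
  by (rule SL2.r_coset_subset_G)

lemma mem_rcoset_iff:
  assumes "B \<subseteq> G" "g \<in> G" "x \<in> G"
  shows "x \<in> B #>\<^bsub>SL2\<^esub> g \<longleftrightarrow> x ** inv\<^bsub>SL2\<^esub> g \<in> B"
proof
  assume "x \<in> B #>\<^bsub>SL2\<^esub> g"
  then show "x ** inv\<^bsub>SL2\<^esub> g \<in> B" using assms by (auto simp: r_coset_def)
next
  assume "x ** inv\<^bsub>SL2\<^esub> g \<in> B"
  then show "x \<in> B #>\<^bsub>SL2\<^esub> g" using assms by (force simp: r_coset_def)
qed

lemma rcoset_mult:
  assumes "B \<subseteq> G" "g \<in> G" "h \<in> G"
  shows "(\<lambda>x. x ** h) ` (B #>\<^bsub>SL2\<^esub> g) = B #>\<^bsub>SL2\<^esub> (g ** h)"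
  by (auto simp: r_coset_def matrix_mul_assoc image_iff)

lemma rcoset_one [simp]: "B \<subseteq> G \<Longrightarrow> B #>\<^bsub>SL2\<^esub> mat 1 = B"
  using SL2.coset_mult_one by simp

lemma subgroup_rcoset_eq:
  assumes "subgroup H SL2" "g \<in> G" "x \<in> H #>\<^bsub>SL2\<^esub> g"
  shows "H #>\<^bsub>SL2\<^esub> x = H #>\<^bsub>SL2\<^esub> g"
  using SL2.repr_independence[OF assms(3,2,1)] by simp

text \<open>A subgroup is the only one among its cosets that contains \<open>mat 1\<close>.\<close>

lemma pt_inj: assumes "pt v = pt w" shows "stab v = stab w"
proof -
  have "stab v \<in> rcosets\<^bsub>SL2\<^esub> (stab w)"
    using assms subgroup.subgroup_in_rcosets[OF subgroup_stab[of v] SL2.is_group] by (simp add: pt_def)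
  then obtain g where g: "g \<in> G" "stab v = stab w #>\<^bsub>SL2\<^esub> g" by (auto simp: RCOSETS_def)
  then have "mat 1 \<in> stab w #>\<^bsub>SL2\<^esub> g" using one_stab by metis
  then have "stab w #>\<^bsub>SL2\<^esub> mat 1 = stab w #>\<^bsub>SL2\<^esub> g" by (rule subgroup_rcoset_eq[OF subgroup_stab g(1)])
  then show ?thesis using g(2) rcoset_one[OF stab_subset] by simp
qed

lemma flat_blocks_iff:
  "X \<in> blocks \<longleftrightarrow> (\<exists>B\<in>insert S \<D>. \<exists>g\<in>G. X = Affine ` (B #>\<^bsub>SL2\<^esub> g)) \<or>
     (\<exists>v g. v \<noteq> 0 \<and> g \<in> G \<and> X = sblock v g) \<or> X = Inft"
proof -
  have short: "X \<in> {insert (Infinite c) (Affine ` B) | c B. c \<in> flat_parallelism p \<and> B \<in> c} \<longleftrightarrow>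
    (\<exists>v g. v \<noteq> 0 \<and> g \<in> G \<and> X = sblock v g)" (is "?l \<longleftrightarrow> ?r")
  proof
    assume ?l
    then obtain c B where X: "X = insert (Infinite c) (Affine ` B)" and c: "c \<in> flat_parallelism p" "B \<in> c"
      by blast
    from c obtain v where v: "v \<noteq> 0" "c = rcosets\<^bsub>SL2\<^esub> (stab v)"
      by (auto simp: flat_parallelism_def sylow_subgroups_eq)
    with c obtain g where "g \<in> G" "B = stab v #>\<^bsub>SL2\<^esub> g" by (auto simp: RCOSETS_def)
    then show ?r using v X by (auto simp: sblock_def pt_def)
  next
    assume ?r
    then obtain v g where "v \<noteq> 0" "g \<in> G" "X = sblock v g" by blast
    then have "rcosets\<^bsub>SL2\<^esub> (stab v) \<in> flat_parallelism p" "stab v #>\<^bsub>SL2\<^esub> g \<in> rcosets\<^bsub>SL2\<^esub> (stab v)"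
      "X = insert (Infinite (rcosets\<^bsub>SL2\<^esub> (stab v))) (Affine ` (stab v #>\<^bsub>SL2\<^esub> g))"
      by (auto simp: flat_parallelism_def sylow_subgroups_eq RCOSETS_def sblock_def pt_def)
    then show ?l by blast
  qed
  have long: "X \<in> {Affine ` B | B. B \<in> long_blocks S \<D>} \<longleftrightarrow>
    (\<exists>B\<in>insert S \<D>. \<exists>g\<in>G. X = Affine ` (B #>\<^bsub>SL2\<^esub> g))"
    unfolding long_blocks_def mem_Collect_eq by metis
  show ?thesis unfolding flat_blocks_def Un_iff short long singleton_iff disj_assoc by (rule refl)
qed

lemma flat_points_eq: "flat_points p = Affine ` G \<union> Inft"
  by (simp add: flat_points_def block_at_infinity_def)

lemma finite_flat_points: "finite (flat_points p :: 'a upoint set)"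
  by (simp add: flat_points_eq Inft_eq)

lemma long_subset: "B \<in> insert S \<D> \<Longrightarrow> B \<subseteq> G"
  using S_subset D_subset by auto

lemma flat_blocks_cases [consumes 1, case_names long short infinity]:
  assumes "X \<in> blocks"
  obtains B g where "B \<in> insert S \<D>" "g \<in> G" "X = Affine ` (B #>\<^bsub>SL2\<^esub> g)"
    | v g where "v \<noteq> 0" "g \<in> G" "X = sblock v g" | "X = Inft"
  using assms unfolding flat_blocks_iff by (elim disjE bexE exE conjE) assumption+

lemma blocks_subset: assumes "X \<in> blocks" shows "X \<subseteq> flat_points p"
proof -
  from assms show ?thesis
  proof (cases rule: flat_blocks_cases)
    case (long B g)
    then have "B #>\<^bsub>SL2\<^esub> g \<subseteq> G" by (intro rcoset_subset long_subset)
    then show ?thesis unfolding long flat_points_eq by blast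
  next
    case (short v g)
    then have "stab v #>\<^bsub>SL2\<^esub> g \<subseteq> G" by (intro rcoset_subset stab_subset)
    then show ?thesis unfolding short flat_points_eq sblock_def Inft_eq using short(1) by blast
  qed (simp add: flat_points_eq)
qed

lemma finite_blocks: "finite blocks"
  using finite_subset[of blocks "Pow (flat_points p)"] blocks_subset finite_flat_points by blast

lemma Affine_notin_Inft [simp]: "Affine g \<notin> Inft"
  by (auto simp: Inft_eq pt_def)

lemma pt_in_Inft [simp]: "v \<noteq> 0 \<Longrightarrow> pt v \<in> Inft"
  by (auto simp: Inft_eq)

lemma InftE: assumes "x \<in> Inft" obtains v where "v \<noteq> 0" "x = pt v"
  using assms unfolding Inft_eq by blast

lemma pt_neq_Affine [simp]: "pt v \<noteq> Affine g" "Affine g \<noteq> pt v"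
  by (auto simp: pt_def)

lemma block_meets_Inft:
  assumes "X \<in> blocks" "X \<noteq> Inft" "pt v \<in> X"
  obtains g where "g \<in> G" "X = sblock v g"
proof -
  obtain w g where wg: "w \<noteq> 0" "g \<in> G" "X = sblock w g"
    using assms by (auto simp: flat_blocks_iff)
  then have "pt v = pt w" using assms by (auto simp: sblock_def)
  then have "stab v = stab w" by (rule pt_inj)
  then have "X = sblock v g" using wg \<open>pt v = pt w\<close> by (simp add: sblock_def)
  then show ?thesis using that wg by blast
qed

lemma block_avoids_Inft:
  assumes "X \<in> blocks" "X \<inter> Inft = {}"
  obtains B g where "B \<in> insert S \<D>" "g \<in> G" "X = Affine ` (B #>\<^bsub>SL2\<^esub> g)"
proof -
  have "axis 1 1 \<noteq> (0::'a^2)" by (simp add: vec2_eq_iff axis_def)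
  then have "Inft \<noteq> {}" using pt_in_Inft by blast
  then have "X \<noteq> Inft" using assms(2) by auto
  moreover have "X \<noteq> sblock v g" if "v \<noteq> 0" for v g using assms(2) that by (auto simp: sblock_def)
  ultimately show ?thesis by (cases rule: flat_blocks_cases[OF assms(1)]) (use that in auto)
qed

subsection \<open>The automorphism group\<close>

text \<open>The type of points has elements outside \<open>flat_points p\<close>; fixing them makes
  equality of automorphisms equality of functions. Preserving blocks in one direction suffices
  because there are finitely many blocks.\<close>

definition auts :: "('a upoint \<Rightarrow> 'a upoint) set" where
  "auts = {f. f permutes flat_points p \<and> (\<forall>X\<in>blocks. f ` X \<in> blocks)}"

lemma auts_bij: "f \<in> auts \<Longrightarrow> bij f"
  by (auto simp: auts_def permutes_bij)

lemma auts_inv_simps [simp]: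
  assumes "f \<in> auts"
  shows "f (finv f x) = x" "finv f (f x) = x" "f ` finv f ` X = X" "finv f ` f ` X = X"
    "f x = f y \<longleftrightarrow> x = y" "finv f x = finv f y \<longleftrightarrow> x = y" "f ` X = f ` Y \<longleftrightarrow> X = Y"
    "finv f ` X = finv f ` Y \<longleftrightarrow> X = Y" "f x \<in> f ` X \<longleftrightarrow> x \<in> X" "finv f x \<in> X \<longleftrightarrow> x \<in> f ` X"
proof -
  note b = auts_bij[OF assms]
  then have i: "inj f" "surj f" by (auto simp: bij_def)
  show a: "f (finv f x) = x" "finv f (f x) = x" for x using i by (auto simp: surj_f_inv_f)
  show "f ` finv f ` X = X" "finv f ` f ` X = X" by (auto simp: image_image a)
  show "f x = f y \<longleftrightarrow> x = y" "f ` X = f ` Y \<longleftrightarrow> X = Y" "f x \<in> f ` X \<longleftrightarrow> x \<in> X"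
    using i by (auto simp: inj_eq inj_image_eq_iff inj_image_mem_iff)
  have "inj (finv f)" using b bij_imp_bij_inv bij_is_inj by blast
  then show "finv f x = finv f y \<longleftrightarrow> x = y" "finv f ` X = finv f ` Y \<longleftrightarrow> X = Y"
    by (auto simp: inj_eq inj_image_eq_iff)
  show "finv f x \<in> X \<longleftrightarrow> x \<in> f ` X" using a by (metis image_iff)
qed

lemma auts_comp [intro]: "f \<in> auts \<Longrightarrow> g \<in> auts \<Longrightarrow> f \<circ> g \<in> auts"
  unfolding auts_def mem_Collect_eq image_comp[symmetric] by (blast intro: permutes_compose)

lemma auts_inv [intro]: assumes "f \<in> auts" shows "finv f \<in> auts"
proof -
  have "(`) f ` blocks = blocks"
    using assms by (intro endo_inj_surj finite_blocks) (auto simp: auts_def inj_on_def auts_inv_simps(7)[OF assms])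
  then have "finv f ` X \<in> blocks" if "X \<in> blocks" for X
    using that auts_inv_simps(4)[OF assms] by (metis imageE)
  then show ?thesis using assms by (auto simp: auts_def permutes_inv)
qed

lemma auts_blocks: "f \<in> auts \<Longrightarrow> X \<in> blocks \<Longrightarrow> f ` X \<in> blocks"
  by (auto simp: auts_def)

lemma auts_image_Inft: "f \<in> auts \<Longrightarrow> f ` Inft \<in> blocks"
  by (rule auts_blocks) (auto simp: flat_blocks_iff)

lemma auts_points: "f \<in> auts \<Longrightarrow> x \<in> flat_points p \<Longrightarrow> f x \<in> flat_points p"
  by (auto simp: auts_def permutes_in_image)

lemma auts_outside: "f \<in> auts \<Longrightarrow> x \<notin> flat_points p \<Longrightarrow> f x = x"
  by (auto simp: auts_def permutes_not_in)

section \<open>Right multiplications\<close>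

text \<open>Matrices outside \<open>G\<close> are fixed, as membership in \<open>auts\<close>
  demands. Points at infinity are fixed because a right translate of a right coset of
  \<open>stab v\<close> is again one.\<close>

definition rmul :: "'a^2^2 \<Rightarrow> 'a upoint \<Rightarrow> 'a upoint" where
  "rmul h x = (case x of Affine g \<Rightarrow> Affine (if g \<in> G then g ** h else g) | Infinite c \<Rightarrow> x)"

lemma rmul_Affine [simp]: "g \<in> G \<Longrightarrow> rmul h (Affine g) = Affine (g ** h)"
  and rmul_pt [simp]: "rmul h (pt v) = pt v"
  by (auto simp: rmul_def pt_def)

lemma rmul_Inft [simp]: "x \<in> Inft \<Longrightarrow> rmul h x = x"
  by (auto simp: Inft_eq)

lemma rmul_image_Inft [simp]: "rmul h ` Inft = Inft"
  by (auto simp: image_iff)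

lemma rmul_image_Affine: "B \<subseteq> G \<Longrightarrow> g \<in> G \<Longrightarrow> h \<in> G \<Longrightarrow>
    rmul h ` Affine ` (B #>\<^bsub>SL2\<^esub> g) = Affine ` (B #>\<^bsub>SL2\<^esub> (g ** h))"
  by (subst rcoset_mult[symmetric]) (use rcoset_subset[of B g] in \<open>auto simp: image_image subset_iff intro!: image_cong\<close>)

lemma rmul_image_sblock: "g \<in> G \<Longrightarrow> h \<in> G \<Longrightarrow> rmul h ` sblock v g = sblock v (g ** h)"
  by (simp add: sblock_def rmul_image_Affine stab_subset)

lemma rmul_comp: "g \<in> G \<Longrightarrow> h \<in> G \<Longrightarrow> rmul g \<circ> rmul h = rmul (h ** g)"
  by (auto simp: rmul_def fun_eq_iff matrix_mul_assoc SL2_mult_closed split: upoint.split)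

lemma rmul_one: "rmul (mat 1) = id"
  by (auto simp: rmul_def fun_eq_iff split: upoint.split)

lemma rmul_auts [intro]: assumes "h \<in> G" shows "rmul h \<in> auts"
proof -
  have i: "rmul h \<circ> rmul (inv\<^bsub>SL2\<^esub> h) = id" "rmul (inv\<^bsub>SL2\<^esub> h) \<circ> rmul h = id"
    using assms by (simp_all add: rmul_comp rmul_one)
  have P: "rmul k x \<in> flat_points p" if "k \<in> G" "x \<in> flat_points p" for k x
    using that by (auto simp: flat_points_eq SL2_mult_closed)
  have "bij_betw (rmul h) (flat_points p) (flat_points p)"
    by (rule bij_betw_byWitness[where f' = "rmul (inv\<^bsub>SL2\<^esub> h)"])
      (use i P assms in \<open>auto simp: fun_eq_iff\<close>)
  moreover have "rmul h x = x" if "x \<notin> flat_points p" for x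
    using that by (cases x) (auto simp: rmul_def flat_points_eq)
  ultimately have "rmul h permutes flat_points p" by (rule bij_imp_permutes)
  moreover have "rmul h ` X \<in> blocks" if "X \<in> blocks" for X
    using that
  proof (cases rule: flat_blocks_cases)
    case (long B g)
    then have "rmul h ` X = Affine ` (B #>\<^bsub>SL2\<^esub> (g ** h))"
      using assms by (simp only: rmul_image_Affine[OF long_subset])
    then show ?thesis using long assms unfolding flat_blocks_iff by (metis SL2_mult_closed)
  next
    case (short v g)
    then have "rmul h ` X = sblock v (g ** h)" using assms by (simp add: rmul_image_sblock)
    then show ?thesis using short assms unfolding flat_blocks_iff by (metis SL2_mult_closed)
  qed (simp add: flat_blocks_iff)
  ultimately show ?thesis by (auto simp: auts_def)
qed

lemma rmul_fixes_Affine: "h \<in> G \<Longrightarrow> g \<in> G \<Longrightarrow> rmul h (Affine g) = Affine g \<Longrightarrow> h = mat 1"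
  by simp (metis SL2_cancel(1) SL2_inv_mult(1))

text \<open>Fixing \<open>pt v\<close> forces \<open>f\<close> to permute the short blocks through
  it, that is, the right cosets of \<open>stab v\<close>. Rigidity then leaves only right
  multiplications.\<close>

lemma fixes_Inft_imp_rmul:
  assumes f: "f \<in> auts" and fix_Inft: "\<And>x. x \<in> Inft \<Longrightarrow> f x = x"
  obtains k where "k \<in> G" "f = rmul k"
proof -
  have "\<exists>h\<in>G. f (Affine g) = Affine h" if g: "g \<in> G" for g
  proof -
    have "f (Affine g) \<in> flat_points p" using auts_points[OF f] g by (auto simp: flat_points_eq)
    moreover have "f (Affine g) \<notin> Inft"
    proof
      assume a: "f (Affine g) \<in> Inft"
      then have "f (f (Affine g)) = f (Affine g)" using fix_Inft by blast
      then show False using f a by simp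
    qed
    ultimately show ?thesis by (auto simp: flat_points_eq)
  qed
  then obtain \<phi> where \<phi>: "\<And>g. g \<in> G \<Longrightarrow> \<phi> g \<in> G" "\<And>g. g \<in> G \<Longrightarrow> f (Affine g) = Affine (\<phi> g)"
    by metis
  have key: "inv\<^bsub>SL2\<^esub> (\<phi> g') *v v = inv\<^bsub>SL2\<^esub> (\<phi> g) *v v \<longleftrightarrow> inv\<^bsub>SL2\<^esub> g' *v v = inv\<^bsub>SL2\<^esub> g *v v"
    if g: "g \<in> G" and g': "g' \<in> G" and v: "v \<noteq> 0" for g g' v
  proof -
    have b: "f ` sblock v g \<in> blocks" using v g by (intro auts_blocks f) (auto simp: flat_blocks_iff)
    have "g \<in> stab v #>\<^bsub>SL2\<^esub> g" using g by (simp add: mem_stab_coset_iff)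
    then have gin: "Affine g \<in> sblock v g" by (auto simp: sblock_def)
    then have gim: "Affine (\<phi> g) \<in> f ` sblock v g" using \<phi>(2)[OF g] by (metis imageI)
    have "pt v \<in> f ` sblock v g" using fix_Inft[of "pt v"] v by (force simp: sblock_def)
    then obtain h where h: "h \<in> G" "f ` sblock v g = sblock v h"
      using block_meets_Inft[OF b] gim by (metis Affine_notin_Inft)
    have mem: "Affine x \<in> sblock v k \<longleftrightarrow> inv\<^bsub>SL2\<^esub> x *v v = inv\<^bsub>SL2\<^esub> k *v v" if "x \<in> G" "k \<in> G" for x k
      using mem_stab_coset_iff[of k x v] that by (auto simp: sblock_def)
    have "Affine (\<phi> g') \<in> f ` sblock v g \<longleftrightarrow> Affine g' \<in> sblock v g"
      using \<phi>(2)[OF g'] f by (metis auts_inv_simps(9))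
    then show ?thesis using gim h mem \<phi> g g' by simp
  qed
  \<comment> \<open>The factor \<open>k\<close> normalises the map sending \<open>h\<close> to
    \<open>k (\<phi> (h^-1))^-1\<close> so that it fixes \<open>mat 1\<close>. By rigidity this map
    is the identity, which means \<open>\<phi> g = g k\<close>.\<close>
  define k where "k = \<phi> (mat 1)"
  have k: "k \<in> G" using \<phi> by (simp add: k_def)
  have "k ** inv\<^bsub>SL2\<^esub> (\<phi> (inv\<^bsub>SL2\<^esub> h)) = h" if "h \<in> G" for h
  proof (rule SL2_rigidity[where F = "\<lambda>h. k ** inv\<^bsub>SL2\<^esub> (\<phi> (inv\<^bsub>SL2\<^esub> h))", OF card_ge_3])
    fix g h :: "'a^2^2" and v :: "'a^2" assume gh: "g \<in> G" "h \<in> G" "v \<noteq> 0"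
    then show "(k ** inv\<^bsub>SL2\<^esub> \<phi> (inv\<^bsub>SL2\<^esub> g)) *v v = (k ** inv\<^bsub>SL2\<^esub> \<phi> (inv\<^bsub>SL2\<^esub> h)) *v v \<longleftrightarrow> g *v v = h *v v"
      using key[of "inv\<^bsub>SL2\<^esub> h" "inv\<^bsub>SL2\<^esub> g" v] k
      by (simp add: matrix_vector_mul_assoc[symmetric] SL2_mult_vector_eq_iff)
  next
    show "k ** inv\<^bsub>SL2\<^esub> \<phi> (inv\<^bsub>SL2\<^esub> mat 1) = mat 1"
      using k by (simp add: k_def)
  qed (use \<phi> k that in \<open>auto intro: SL2_mult_closed\<close>)
  then have "k ** inv\<^bsub>SL2\<^esub> (\<phi> g) = inv\<^bsub>SL2\<^esub> g" if "g \<in> G" for g using that by (metis SL2.inv_closed SL2.inv_inv)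
  then have gk: "\<phi> g = g ** k" if "g \<in> G" for g
    using that k \<phi>(1) by (metis SL2_cancel(2,4))
  have "f x = rmul k x" for x
  proof (cases "x \<in> flat_points p")
    case True
    then show ?thesis using fix_Inft \<phi>(2) gk by (auto simp: flat_points_eq)
  qed (use auts_outside[OF f] auts_outside[OF rmul_auts[OF k]] in simp)
  then show ?thesis using that k by blast
qed

text \<open>Conjugating a right multiplication by \<open>f\<close> gives an automorphism fixing
  \<open>Inft\<close> pointwise, hence another right multiplication; evaluation at
  \<open>mat 1\<close> shows that its factor is \<open>\<theta> h\<close>.\<close>

lemma stabilises_Inft_hom:
  assumes f: "f \<in> auts" "f ` Inft = Inft" "f (Affine (mat 1)) = Affine (mat 1)"
  obtains \<theta> where "\<And>g. g \<in> G \<Longrightarrow> \<theta> g \<in> G" "\<And>g. g \<in> G \<Longrightarrow> f (Affine g) = Affine (\<theta> g)"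
    "\<And>g h. g \<in> G \<Longrightarrow> h \<in> G \<Longrightarrow> \<theta> (g ** h) = \<theta> g ** \<theta> h" "\<theta> (mat 1) = mat 1" "inj_on \<theta> G"
proof -
  have "\<exists>h\<in>G. f (Affine g) = Affine h" if g: "g \<in> G" for g
  proof -
    have "f (Affine g) \<in> flat_points p" using auts_points[OF f(1)] g by (auto simp: flat_points_eq)
    moreover have "f (Affine g) \<notin> Inft" using f by (metis Affine_notin_Inft auts_inv_simps(9))
    ultimately show ?thesis by (auto simp: flat_points_eq)
  qed
  then obtain \<theta> where \<theta>: "\<And>g. g \<in> G \<Longrightarrow> \<theta> g \<in> G" "\<And>g. g \<in> G \<Longrightarrow> f (Affine g) = Affine (\<theta> g)"
    by metis
  have "\<theta> (g ** h) = \<theta> g ** \<theta> h" if gh: "g \<in> G" "h \<in> G" for g h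
  proof -
    have "f \<circ> rmul h \<circ> finv f \<in> auts" using f gh by auto
    moreover have "(f \<circ> rmul h \<circ> finv f) x = x" if "x \<in> Inft" for x
      using that f by simp
    ultimately obtain k where k: "k \<in> G" "f \<circ> rmul h \<circ> finv f = rmul k"
      by (rule fixes_Inft_imp_rmul)
    then have *: "f (rmul h x) = rmul k (f x)" for x
      using f(1) by (metis auts_inv_simps(2) comp_apply)
    from *[of "Affine (mat 1)"] have "\<theta> h = k" using gh f(3) \<theta> k by simp
    then show ?thesis using *[of "Affine g"] gh \<theta> by (simp add: SL2_mult_closed)
  qed
  moreover have "\<theta> (mat 1) = mat 1" using \<theta>(2)[of "mat 1"] f(3) by simp
  moreover have "inj_on \<theta> G" using \<theta>(2) f(1) by (metis auts_inv_simps(5) inj_onI upoint.inject(1))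
  ultimately show ?thesis using that \<theta> by blast
qed

end

subsection \<open>Involutions\<close>

lemma neg_one_notin_stab:
  assumes odd: "(2::'a::{field,finite}) \<noteq> 0" and v: "v \<noteq> (0::'a^2)" shows "mat (- 1) \<notin> stab v"
proof
  assume "mat (- 1) \<in> stab v"
  then have "- v = v" by (simp add: stab_def)
  then have "v$1 + v$1 = 0" "v$2 + v$2 = 0" by (metis add.right_inverse vector_uminus_component)+
  then have "v$1 = 0" "v$2 = 0" using odd by (metis mult_2 mult_eq_0_iff)+
  then show False using v by (simp add: vec2_eq_iff)
qed

lemma neg_one_neq_one: assumes "(2::'a::field) \<noteq> 0" shows "mat (- 1) \<noteq> (mat 1 :: 'a^2^2)"
proof
  assume "mat (- 1) = (mat 1 :: 'a^2^2)"
  then have "- 1 = (1::'a)" by (simp add: mat2_eq_iff mat_def)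
  then have "1 + 1 = (0::'a)" by (metis add.right_inverse)
  then show False using assms by simp
qed

lemma neg_one_square: "mat (- 1) ** mat (- 1) = (mat 1 :: 'a::field^2^2)"
  by (simp add: mat2_eq_iff matrix_mult_2 mat_def)

text \<open>For \<open>dt v w = 1\<close> such a \<open>t\<close> sends \<open>w\<close> to
  \<open>w + c v\<close>, and doing this twice adds \<open>2 c v = 0\<close>.\<close>

lemma stab_involution:
  assumes "(2::'a::{field,finite}) = 0" "v \<noteq> 0" "t \<in> stab (v::'a^2)"
  shows "t ** t = mat 1"
proof -
  obtain w where w: "dt v w = 1" by (rule ex_dt_eq_1[OF assms(2)])
  have t: "t \<in> carrier SL2" "t *v v = v" using assms(3) by (auto simp: stab_def)
  have "dt v (t *v w) = 1" using dt_SL2[OF t(1), of v w] t w by simp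
  then have "dt v (t *v w - w) = 0" using w by simp
  then obtain c where "t *v w - w = c *s v" using dt_eq_0_imp_multiple assms(2) by blast
  then have tw: "t *v w = w + c *s v" by (simp add: algebra_simps)
  have "c *s v + c *s v = 0" by (simp add: vec2_eq_iff mult_2[symmetric] assms(1))
  then have "t *v (t *v w) = w"
    by (simp add: tw matrix_vector_right_distrib vector_scalar_commute t add.assoc)
  then show ?thesis
    using matrix_eq_on_basis[of v w "t ** t" "mat 1"] w t by (simp add: matrix_vector_mul_assoc[symmetric])
qed

text \<open>If \<open>g\<close> moves \<open>x\<close>, then \<open>x + g x\<close> is a fixed
  vector, and it is nonzero because \<open>- x = x\<close>.\<close>

lemma involution_in_stab:
  assumes "(2::'a::{field,finite}) = 0" "g \<in> carrier SL2" "g ** g = (mat 1 :: 'a^2^2)"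
  obtains v where "v \<noteq> 0" "g \<in> stab v"
proof (cases "g = mat 1")
  case True
  have "axis 1 1 \<noteq> (0::'a^2)" by (simp add: vec2_eq_iff axis_def)
  then show ?thesis using that[of "axis 1 1"] True assms(2) by (simp add: stab_def)
next
  case False
  then obtain x where x: "g *v x \<noteq> x" by (auto simp: matrix_eq)
  have "x + x = 0" by (simp add: vec2_eq_iff mult_2[symmetric] assms(1))
  then have "x + g *v x \<noteq> 0" using x by (metis add_left_cancel)
  moreover have "g *v (x + g *v x) = x + g *v x"
    using assms(3) by (simp add: matrix_vector_right_distrib matrix_vector_mul_assoc add.commute)
  ultimately show ?thesis using that assms(2) by (auto simp: stab_def)
qed

lemma involution_odd_char:
  assumes "(2::'a::{field,finite}) \<noteq> 0" "g \<in> carrier SL2" "g ** g = (mat 1 :: 'a^2^2)"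
  shows "g = mat 1 \<or> g = mat (- 1)"
proof -
  define a b c d where abcd: "a = g$1$1" "b = g$1$2" "c = g$2$1" "d = g$2$2"
  have e: "a * a + b * c = 1" "a * b + b * d = 0" "c * a + d * c = 0" "a * d - b * c = 1"
    using assms(2,3) by (simp_all add: abcd mat2_eq_iff matrix_mult_2 mat_1_2 carrier_SL2 det_2)
  \<comment> \<open>With trace 0 the equations for \<open>g^2 = 1\<close> and
    \<open>det g = 1\<close> would add up to \<open>2 = 0\<close>. A nonzero trace then makes the
    off-diagonal entries vanish.\<close>
  have "a + d \<noteq> 0"
  proof
    assume "a + d = 0"
    then have "d = - a" by (simp add: eq_neg_iff_add_eq_0 add.commute)
    then have "(a * a + b * c) + (a * d - b * c) = 0" by simp
    then show False using assms(1) unfolding e(1,4) by simp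
  qed
  moreover have "b * (a + d) = 0" "c * (a + d) = 0" using e by (simp_all add: algebra_simps)
  ultimately have bc: "b = 0" "c = 0" by auto
  then have "a * a = 1" "a * d = 1" using e by auto
  then have "a = d" "a = 1 \<or> a = - 1" by (metis mult_left_cancel mult_zero_left zero_neq_one, simp add: square_eq_1_iff)
  then show ?thesis using bc by (auto simp: abcd mat2_eq_iff mat_def)
qed

subsection \<open>Images of the block at infinity\<close>

context flat_unital
begin

text \<open>If \<open>D g\<close> is a subgroup, it contains all quotients
  \<open>x y^-1 = (x g) (y g)^-1\<close> of \<open>D\<close>; by condition (Q) there are
  \<open>q (q + 1)\<close> of them, too many for \<open>q + 1\<close> elements.\<close>

lemma long_block_subgroup:
  assumes B: "B \<in> insert S \<D>" and g: "g \<in> G" and sub: "subgroup (B #>\<^bsub>SL2\<^esub> g) SL2"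
  shows "B #>\<^bsub>SL2\<^esub> g = S"
proof (cases "B = S")
  case True
  have "mat 1 \<in> S #>\<^bsub>SL2\<^esub> g" using subgroup.one_closed[OF sub] True by simp
  then show ?thesis using subgroup_rcoset_eq[OF subgroup_S g, of "mat 1"] True rcoset_one[OF S_subset] by simp
next
  case False
  then have D: "B \<in> \<D>" using B by simp
  have "quotients SL2 B \<subseteq> B #>\<^bsub>SL2\<^esub> g"
  proof
    fix z assume "z \<in> quotients SL2 B"
    then obtain x y where xy: "x \<in> B" "y \<in> B" "z = x ** inv\<^bsub>SL2\<^esub> y" by (auto simp: quotients_def)
    then have c: "x \<in> G" "y \<in> G" using D_subset[OF D] by auto
    have "x ** g \<in> B #>\<^bsub>SL2\<^esub> g" "y ** g \<in> B #>\<^bsub>SL2\<^esub> g" using xy by (auto simp: r_coset_def)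
    then have "(x ** g) ** inv\<^bsub>SL2\<^esub> (y ** g) \<in> B #>\<^bsub>SL2\<^esub> g"
      using subgroup.m_closed[OF sub _ subgroup.m_inv_closed[OF sub]] by simp
    moreover have "(x ** g) ** inv\<^bsub>SL2\<^esub> (y ** g) = z"
      using SL2.inv_mult_group[OF c(2) g] g xy by (simp add: matrix_mul_assoc)
    ultimately show "z \<in> B #>\<^bsub>SL2\<^esub> g" by simp
  qed
  then have "card (quotients SL2 B) \<le> card (B #>\<^bsub>SL2\<^esub> g)" by (intro card_mono) auto
  also have "B #>\<^bsub>SL2\<^esub> g = (\<lambda>x. x ** g) ` B" by (auto simp: r_coset_def)
  also have "card \<dots> \<le> card B" by (rule card_image_le) simp
  finally have "CARD('a) * (CARD('a) + 1) \<le> 1 * (CARD('a) + 1)"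
    using card_quotients[OF D] card_D[OF D] by simp
  then show ?thesis using card_ge_3 by (subst (asm) mult_le_cancel2) simp
qed

text \<open>\<open>f\<close> acts on \<open>G\<close> as a group automorphism, so the image of
  \<open>S\<close> is both a subgroup and a long block, and only \<open>S\<close> is both.\<close>

lemma stabiliser_preserves_S:
  assumes f: "f \<in> auts" "f ` Inft = Inft" "f (Affine (mat 1)) = Affine (mat 1)"
  shows "f ` Affine ` S = Affine ` S"
proof -
  obtain \<theta> where \<theta>: "\<And>g. g \<in> G \<Longrightarrow> \<theta> g \<in> G" "\<And>g. g \<in> G \<Longrightarrow> f (Affine g) = Affine (\<theta> g)"
    "\<And>g h. g \<in> G \<Longrightarrow> h \<in> G \<Longrightarrow> \<theta> (g ** h) = \<theta> g ** \<theta> h" "\<theta> (mat 1) = mat 1" "inj_on \<theta> G"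
    by (rule stabilises_Inft_hom[OF f]) blast
  have SG: "s \<in> G" if "s \<in> S" for s using that S_subset by blast
  have im: "f ` Affine ` S = Affine ` \<theta> ` S" using \<theta>(2) SG by (force simp: image_image intro!: image_cong)
  have "Affine ` S \<in> blocks" unfolding flat_blocks_iff using rcoset_one[OF S_subset] one_G by (metis insertI1)
  then have "f ` Affine ` S \<in> blocks" by (rule auts_blocks[OF f(1)])
  moreover have "f ` Affine ` S \<inter> Inft = {}" unfolding im by auto
  ultimately obtain B g where Bg: "B \<in> insert S \<D>" "g \<in> G" "f ` Affine ` S = Affine ` (B #>\<^bsub>SL2\<^esub> g)"
    by (rule block_avoids_Inft)
  then have eq: "\<theta> ` S = B #>\<^bsub>SL2\<^esub> g" unfolding im by (metis (no_types) inj_image_eq_iff inj_onI upoint.inject(1))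
  have "subgroup (\<theta> ` S) SL2"
  proof (rule SL2.subgroupI)
    fix a assume "a \<in> \<theta> ` S"
    then obtain s where s: "s \<in> S" "a = \<theta> s" by auto
    have si: "inv\<^bsub>SL2\<^esub> s \<in> S" using subgroup.m_inv_closed[OF subgroup_S s(1)] .
    have "\<theta> (inv\<^bsub>SL2\<^esub> s) ** \<theta> s = mat 1" using \<theta>(3)[of "inv\<^bsub>SL2\<^esub> s" s] \<theta>(4) SG s si by simp
    then have "inv\<^bsub>SL2\<^esub> a = \<theta> (inv\<^bsub>SL2\<^esub> s)"
      using \<theta>(1) SG s si by (intro SL2.inv_equality) auto
    then show "inv\<^bsub>SL2\<^esub> a \<in> \<theta> ` S" using si by simp
    fix b assume "b \<in> \<theta> ` S"
    then obtain s' where "s' \<in> S" "b = \<theta> s'" by auto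
    then have "a ** b = \<theta> (s ** s')" "s ** s' \<in> S"
      using s \<theta>(3) SG subgroup.m_closed[OF subgroup_S, of s s'] by auto
    then show "a \<otimes>\<^bsub>SL2\<^esub> b \<in> \<theta> ` S" by simp
  next
    show "\<theta> ` S \<noteq> {}" using one_S by blast
  qed (use \<theta>(1) SG in auto)
  then have "\<theta> ` S = S" using long_block_subgroup[OF Bg(1,2)] eq by simp
  then show ?thesis unfolding im by simp
qed

text \<open>The classical argument on fixed-point-free automorphisms: sending \<open>s\<close> to
  \<open>s^-1 (\<theta> s)\<close> is injective on the finite group \<open>S\<close>, so every
  element has the form \<open>y^-1 (\<theta> y)\<close>, and \<open>\<theta>\<close> inverts
  elements of this form.\<close>

lemma inverted_S:
  assumes f: "f \<in> auts" "f ` Inft = Inft" "f (Affine (mat 1)) = Affine (mat 1)"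
    and invol: "\<And>x. f (f x) = x"
    and free: "\<And>s. s \<in> S \<Longrightarrow> f (Affine s) = Affine s \<Longrightarrow> s = mat 1"
    and s: "s \<in> S"
  shows "f (Affine s) = Affine (inv\<^bsub>SL2\<^esub> s)"
proof -
  obtain \<theta> where \<theta>: "\<And>g. g \<in> G \<Longrightarrow> \<theta> g \<in> G" "\<And>g. g \<in> G \<Longrightarrow> f (Affine g) = Affine (\<theta> g)"
    "\<And>g h. g \<in> G \<Longrightarrow> h \<in> G \<Longrightarrow> \<theta> (g ** h) = \<theta> g ** \<theta> h" "\<theta> (mat 1) = mat 1" "inj_on \<theta> G"
    by (rule stabilises_Inft_hom[OF f]) blast
  have SG: "s \<in> G" if "s \<in> S" for s using that S_subset by blast
  have Si: "inv\<^bsub>SL2\<^esub> s \<in> S" if "s \<in> S" for s using subgroup.m_inv_closed[OF subgroup_S that] .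
  have Sm: "s ** t \<in> S" if "s \<in> S" "t \<in> S" for s t using subgroup.m_closed[OF subgroup_S that] by simp
  have \<theta>S: "\<theta> s \<in> S" if "s \<in> S" for s
  proof -
    have "f (Affine s) \<in> f ` Affine ` S" using that by blast
    then have "Affine (\<theta> s) \<in> Affine ` S" using \<theta>(2)[OF SG[OF that]] stabiliser_preserves_S[OF f] by simp
    then show ?thesis by auto
  qed
  have \<theta>\<theta>: "\<theta> (\<theta> s) = s" if "s \<in> S" for s
    using invol[of "Affine s"] \<theta>(1,2) SG[OF that] by simp
  have \<theta>inv: "\<theta> (inv\<^bsub>SL2\<^esub> s) = inv\<^bsub>SL2\<^esub> (\<theta> s)" if "s \<in> S" for s
  proof -
    have "\<theta> (inv\<^bsub>SL2\<^esub> s) ** \<theta> s = mat 1" using \<theta>(3)[of "inv\<^bsub>SL2\<^esub> s" s] \<theta>(4) SG that by simp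
    then show ?thesis using \<theta>(1) SG that by (intro SL2.inv_equality[symmetric]) auto
  qed
  define d where "d s = inv\<^bsub>SL2\<^esub> s ** \<theta> s" for s
  have "inj_on d S"
  proof (rule inj_onI)
    fix s t assume st: "s \<in> S" "t \<in> S" "d s = d t"
    then have c: "s \<in> G" "t \<in> G" "\<theta> s \<in> G" "\<theta> t \<in> G" using SG \<theta>(1) by auto
    have "t ** inv\<^bsub>SL2\<^esub> s = t ** (inv\<^bsub>SL2\<^esub> s ** \<theta> s) ** inv\<^bsub>SL2\<^esub> (\<theta> s)"
      using c by (simp add: matrix_mul_assoc[symmetric])
    also have "\<dots> = \<theta> t ** inv\<^bsub>SL2\<^esub> (\<theta> s)" using st(3) c by (simp add: d_def)
    also have "\<dots> = \<theta> (t ** inv\<^bsub>SL2\<^esub> s)" using \<theta>(3) \<theta>inv st c by simp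
    finally have "f (Affine (t ** inv\<^bsub>SL2\<^esub> s)) = Affine (t ** inv\<^bsub>SL2\<^esub> s)"
      using \<theta>(2) c by (simp add: SL2_mult_closed)
    then have "t ** inv\<^bsub>SL2\<^esub> s = mat 1" using free Sm Si st by blast
    then show "s = t" using c by (metis SL2_cancel(4) matrix_mul_lid)
  qed
  moreover have "d ` S \<subseteq> S" using Sm Si \<theta>S by (auto simp: d_def)
  ultimately have "d ` S = S" by (intro endo_inj_surj) auto
  then obtain y where y: "y \<in> S" "s = d y" using s by blast
  have "\<theta> s = inv\<^bsub>SL2\<^esub> (\<theta> y) ** y" using y \<theta>(3) \<theta>inv \<theta>\<theta> \<theta>(1) SG by (simp add: d_def)
  also have "\<dots> = inv\<^bsub>SL2\<^esub> s"
    using y SL2.inv_mult_group[of "inv\<^bsub>SL2\<^esub> y" "\<theta> y"] SG \<theta>(1) by (simp add: d_def)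
  finally show ?thesis using \<theta>(2) SG s by simp
qed

text \<open>If \<open>f ` Inft\<close> were the short block of \<^term>\<open>stab v\<close>, then conjugating right multiplications by
  \<open>f\<close> would give group automorphisms of \<open>SL(2,q)\<close> fixing no affine point outside \<^term>\<open>stab v\<close>.\<close>

lemma Inft_image_disjoint:
  assumes f: "f \<in> auts" "f ` Inft \<noteq> Inft"
  shows "f ` Inft \<inter> Inft = {}"
proof (rule ccontr)
  assume "f ` Inft \<inter> Inft \<noteq> {}"
  then obtain x where x: "x \<in> f ` Inft" "x \<in> Inft" by blast
  then obtain v where v: "v \<noteq> 0" "pt v \<in> f ` Inft" using InftE[OF x(2)] by metis
  then obtain g where g: "g \<in> G" "f ` Inft = sblock v g"
    using block_meets_Inft[OF auts_image_Inft[OF f(1)] f(2)] by blast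
  \<comment> \<open>The right multiplication moves the image of \<open>Inft\<close> to the short
    block through the identity, whose affine part is \<open>stab v\<close>.\<close>
  define k where "k = rmul (inv\<^bsub>SL2\<^esub> g) \<circ> f"
  have k: "k \<in> auts" using f g by (auto simp: k_def)
  have kI: "k ` Inft = sblock v (mat 1)"
    unfolding k_def image_comp[symmetric] g(2) using g(1) by (simp add: rmul_image_sblock)
  have mem_kI: "Affine x \<in> k ` Inft \<longleftrightarrow> x \<in> stab v" for x
    unfolding kI sblock_def using rcoset_one[OF stab_subset] by auto
  have "pt v \<in> k ` Inft" unfolding kI sblock_def by simp
  then have "finv k (pt v) \<in> Inft" using k by simp
  then obtain w where w: "w \<noteq> 0" "finv k (pt v) = pt w" by (rule InftE)
  have bl: "finv k ` Inft \<in> blocks" using k by (intro auts_image_Inft) auto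
  have "finv k ` Inft \<noteq> Inft"
  proof
    assume "finv k ` Inft = Inft"
    then have "k ` Inft = Inft" using k by (metis auts_inv_simps(3))
    then show False using mem_kI[of "mat 1"] by simp
  qed
  moreover have "pt w \<in> finv k ` Inft" using w v by (metis imageI pt_in_Inft)
  ultimately obtain h where h: "h \<in> G" "finv k ` Inft = sblock w h"
    using block_meets_Inft[OF bl] by metis
  \<comment> \<open>The preimage of \<open>Inft\<close> under \<open>k\<close> is the short block of
    \<open>stab w\<close> through \<open>h\<close>. Right multiplication by the conjugate
    \<open>h^-1 t h\<close> leaves it invariant, so \<open>\<tau> t\<close> leaves
    \<open>Inft\<close> invariant.\<close>
  define c where "c t = inv\<^bsub>SL2\<^esub> h ** t ** h" for t
  define \<tau> where "\<tau> t = k \<circ> rmul (c t) \<circ> finv k" for t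
  have c: "c t \<in> G" if "t \<in> stab w" for t
    using that h by (auto simp: c_def stab_def intro!: SL2_mult_closed)
  have c1: "t = mat 1" if "c t = mat 1" for t
  proof -
    have "h ** (c t) ** inv\<^bsub>SL2\<^esub> h = t" using h by (simp add: c_def matrix_mul_assoc[symmetric])
    then show ?thesis using that h by simp
  qed
  have \<tau>: "\<tau> t \<in> auts" if "t \<in> stab w" for t using k c[OF that] by (auto simp: \<tau>_def)
  have \<tau>I: "\<tau> t ` Inft = Inft" if t: "t \<in> stab w" for t
  proof -
    have "h ** c t = t ** h" using h by (simp add: c_def matrix_mul_assoc[symmetric])
    moreover have "t ** h \<in> stab w #>\<^bsub>SL2\<^esub> h" using t by (auto simp: r_coset_def)
    then have "stab w #>\<^bsub>SL2\<^esub> (t ** h) = stab w #>\<^bsub>SL2\<^esub> h" by (rule subgroup_rcoset_eq[OF subgroup_stab h(1)])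
    ultimately have "rmul (c t) ` sblock w h = sblock w h"
      unfolding rmul_image_sblock[OF h(1) c[OF t]] by (simp add: sblock_def)
    then show ?thesis unfolding \<tau>_def image_comp[symmetric] h(2) using h(2) k by (metis auts_inv_simps(3))
  qed
  have \<tau>fix: "\<tau> t (Affine x) = Affine x" if "x \<in> stab v" for t x
  proof -
    have "finv k (Affine x) \<in> Inft" using that mem_kI k by simp
    then show ?thesis using k by (simp add: \<tau>_def)
  qed
  have \<tau>free: "x \<in> stab v" if t: "t \<in> stab w" "t \<noteq> mat 1" and x: "x \<in> G" "\<tau> t (Affine x) = Affine x" for t x
  proof (rule ccontr)
    assume "x \<notin> stab v"
    then have "finv k (Affine x) \<notin> Inft" using mem_kI k by simp
    moreover have "finv k (Affine x) \<in> flat_points p"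
      by (rule auts_points[OF auts_inv[OF k]]) (simp add: flat_points_eq x(1))
    ultimately obtain y where y: "y \<in> G" "finv k (Affine x) = Affine y" unfolding flat_points_eq by blast
    have "rmul (c t) (finv k (Affine x)) = finv k (Affine x)"
      using x(2) k by (metis \<tau>_def auts_inv_simps(2) comp_apply)
    then have "c t = mat 1" using y c[OF t(1)] by (metis rmul_fixes_Affine)
    then show False using c1 t by blast
  qed
  have \<tau>comp: "\<tau> t (\<tau> t' x) = \<tau> (t' ** t) x" if t: "t \<in> stab w" "t' \<in> stab w" for t t' x
  proof -
    have "c t' ** c t = c (t' ** t)"
      using h by (simp add: c_def matrix_mul_assoc[symmetric])
    then show ?thesis using k fun_cong[OF rmul_comp[OF c[OF t(1)] c[OF t(2)]]] by (simp add: \<tau>_def)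
  qed
  have "card (stab w - {mat 1}) \<ge> 2" using card_stab[OF w(1)] card_ge_3 by (simp add: card_Diff_singleton)
  then obtain X where "X \<subseteq> stab w - {mat 1}" "card X = 2" by (rule obtain_subset_with_card_n)
  then obtain t t' where t: "t \<in> stab w" "t \<noteq> mat 1" "t' \<in> stab w" "t' \<noteq> mat 1" "t \<noteq> t'"
    by (auto simp: card_2_iff)
  show False
  proof (cases "(2::'a) = 0")
    case True
    have invS: "\<tau> u (Affine s) = Affine (inv\<^bsub>SL2\<^esub> s)" if u: "u \<in> stab w" "u \<noteq> mat 1" and s: "s \<in> S" for u s
    proof (rule inverted_S[OF \<tau>[OF u(1)] \<tau>I[OF u(1)] \<tau>fix[OF one_stab] _ _ s])
      fix x show "\<tau> u (\<tau> u x) = x"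
        using \<tau>comp[OF u(1) u(1)] stab_involution[OF True w(1) u(1)] k h
        by (simp add: \<tau>_def c_def rmul_one)
    next
      fix s assume "s \<in> S" "\<tau> u (Affine s) = Affine s"
      then show "s = mat 1" using \<tau>free[OF u] S_inter_stab[OF v(1)] S_subset by blast
    qed
    \<comment> \<open>Both \<open>\<tau> t\<close> and \<open>\<tau> t'\<close> invert
      \<open>S\<close>, so \<open>\<tau> (t' t)\<close> fixes \<open>S\<close> pointwise. As
      \<open>t' t\<close> is nontrivial, this puts \<open>S\<close> into \<open>stab v\<close>,
      which has one element fewer.\<close>
    have "t' ** t \<noteq> mat 1"
    proof
      assume a: "t' ** t = mat 1"
      have "t' = t' ** (t ** t)" using stab_involution[OF True w(1) t(1)] by simp
      also have "\<dots> = t" using a by (simp add: matrix_mul_assoc)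
      finally show False using t by simp
    qed
    moreover have "t' ** t \<in> stab w" using subgroup.m_closed[OF subgroup_stab t(3,1)] by simp
    moreover have "\<tau> (t' ** t) (Affine s) = Affine s" if "s \<in> S" for s
    proof -
      have "inv\<^bsub>SL2\<^esub> s \<in> S" "s \<in> G" using that subgroup.m_inv_closed[OF subgroup_S] S_subset by auto
      then show ?thesis using invS[of t' s] invS[of t "inv\<^bsub>SL2\<^esub> s"] t that \<tau>comp[OF t(1,3)]
        by (metis SL2.inv_inv)
    qed
    ultimately have "S \<subseteq> stab v" using \<tau>free S_subset by blast
    then have "card S \<le> card (stab v)" by (intro card_mono) auto
    then show False using card_S card_stab[OF v(1)] by simp
  next
    case False
    obtain \<theta> where \<theta>: "\<And>g. g \<in> G \<Longrightarrow> \<theta> g \<in> G" "\<And>g. g \<in> G \<Longrightarrow> \<tau> t (Affine g) = Affine (\<theta> g)"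
      "\<And>g h. g \<in> G \<Longrightarrow> h \<in> G \<Longrightarrow> \<theta> (g ** h) = \<theta> g ** \<theta> h" "\<theta> (mat 1) = mat 1" "inj_on \<theta> G"
      by (rule stabilises_Inft_hom[OF \<tau>[OF t(1)] \<tau>I[OF t(1)] \<tau>fix[OF one_stab]]) blast
    \<comment> \<open>Being the only involution, \<open>mat (- 1)\<close> is fixed by the group
      automorphism \<open>\<theta>\<close>; but all affine fixed points of \<open>\<tau> t\<close>
      lie in \<open>stab v\<close>.\<close>
    have n: "mat (- 1) \<in> G" by (rule neg_one_SL2)
    note nn = neg_one_neq_one[OF False]
    have "\<theta> (mat (- 1)) ** \<theta> (mat (- 1)) = mat 1" using \<theta>(3)[OF n n] \<theta>(4) by (simp add: neg_one_square)
    then have "\<theta> (mat (- 1)) = mat 1 \<or> \<theta> (mat (- 1)) = mat (- 1)"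
      by (rule involution_odd_char[OF False \<theta>(1)[OF n]])
    then have "\<theta> (mat (- 1)) = mat (- 1)" using \<theta>(4,5) n nn one_G by (metis inj_onD)
    then have "mat (- 1) \<in> stab v" using \<tau>free[OF t(1,2) n] \<theta>(2)[OF n] by simp
    then show False using neg_one_notin_stab[OF False v(1)] by blast
  qed
qed

lemma Inft_images_disjoint:
  assumes "f \<in> auts" "g \<in> auts" "f ` Inft \<inter> g ` Inft \<noteq> {}"
  shows "f ` Inft = g ` Inft"
proof -
  have c: "finv g \<circ> f \<in> auts" using assms by auto
  from assms obtain x y where xy: "x \<in> Inft" "y \<in> Inft" "f x = g y" by auto
  then have "(finv g \<circ> f) x = y" using assms by simp
  then have "(finv g \<circ> f) ` Inft \<inter> Inft \<noteq> {}" using xy by blast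
  then have "finv g ` f ` Inft = Inft" using Inft_image_disjoint[OF c] by (metis image_comp)
  then show ?thesis using assms by (metis auts_inv_simps(3))
qed

text \<open>For every \<open>d\<close> in \<open>B\<close> the translate \<open>B d^-1\<close> is an
  image of \<open>Inft\<close> too, and it contains \<open>mat 1\<close>. Images that meet coincide,
  so \<open>B d^-1 = B\<close>; this makes \<open>B\<close> a subgroup, hence equal to
  \<open>S\<close>.\<close>

lemma Inft_image_cases:
  assumes f: "f \<in> auts" "f ` Inft \<noteq> Inft"
  obtains g where "g \<in> G" "f ` Inft = Affine ` (S #>\<^bsub>SL2\<^esub> g)"
proof -
  obtain B g where B: "B \<in> insert S \<D>" "g \<in> G" "f ` Inft = Affine ` (B #>\<^bsub>SL2\<^esub> g)"
    by (rule block_avoids_Inft[OF auts_image_Inft[OF f(1)] Inft_image_disjoint[OF f]])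
  have "B = S"
  proof (rule ccontr)
    assume "B \<noteq> S"
    then have D: "B \<in> \<D>" using B by simp
    have im: "(rmul (inv\<^bsub>SL2\<^esub> g ** inv\<^bsub>SL2\<^esub> d) \<circ> f) ` Inft = Affine ` (B #>\<^bsub>SL2\<^esub> inv\<^bsub>SL2\<^esub> d)" 
      and au: "rmul (inv\<^bsub>SL2\<^esub> g ** inv\<^bsub>SL2\<^esub> d) \<circ> f \<in> auts" and mem: "Affine (mat 1) \<in> Affine ` (B #>\<^bsub>SL2\<^esub> inv\<^bsub>SL2\<^esub> d)"
      if "d \<in> B" for d
    proof -
      have d: "d \<in> G" using that D_subset[OF D] by auto
      have "rmul (inv\<^bsub>SL2\<^esub> g ** inv\<^bsub>SL2\<^esub> d) ` Affine ` (B #>\<^bsub>SL2\<^esub> g) = Affine ` (B #>\<^bsub>SL2\<^esub> inv\<^bsub>SL2\<^esub> d)"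
        using rmul_image_Affine[OF D_subset[OF D] B(2), of "inv\<^bsub>SL2\<^esub> g ** inv\<^bsub>SL2\<^esub> d"] d B(2) by (simp add: SL2_mult_closed)
      then show "(rmul (inv\<^bsub>SL2\<^esub> g ** inv\<^bsub>SL2\<^esub> d) \<circ> f) ` Inft = Affine ` (B #>\<^bsub>SL2\<^esub> inv\<^bsub>SL2\<^esub> d)"
        using B(3) by (simp only: image_comp[symmetric])
      show "rmul (inv\<^bsub>SL2\<^esub> g ** inv\<^bsub>SL2\<^esub> d) \<circ> f \<in> auts" 
        using f(1) d B(2) by (intro auts_comp rmul_auts SL2_mult_closed) auto
      show "Affine (mat 1) \<in> Affine ` (B #>\<^bsub>SL2\<^esub> inv\<^bsub>SL2\<^esub> d)"
        using that d by (auto simp: mem_rcoset_iff D_subset[OF D])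
    qed
    have absorb: "B #>\<^bsub>SL2\<^esub> inv\<^bsub>SL2\<^esub> d = B" if d: "d \<in> B" for d
    proof -
      have "Affine ` (B #>\<^bsub>SL2\<^esub> inv\<^bsub>SL2\<^esub> d) = Affine ` (B #>\<^bsub>SL2\<^esub> inv\<^bsub>SL2\<^esub> (mat 1))"
        using Inft_images_disjoint[OF au[OF d] au[OF one_D[OF D]]] mem[OF d] mem[OF one_D[OF D]]
        unfolding im[OF d] im[OF one_D[OF D]] by blast
      then have "B #>\<^bsub>SL2\<^esub> inv\<^bsub>SL2\<^esub> d = B #>\<^bsub>SL2\<^esub> inv\<^bsub>SL2\<^esub> (mat 1)"
        by (metis (no_types) inj_image_eq_iff inj_onI upoint.inject(1))
      then show ?thesis using rcoset_one[OF D_subset[OF D]] by simp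
    qed
    have cl: "x ** inv\<^bsub>SL2\<^esub> y \<in> B" if "x \<in> B" "y \<in> B" for x y
    proof -
      have "x ** inv\<^bsub>SL2\<^esub> y \<in> B #>\<^bsub>SL2\<^esub> inv\<^bsub>SL2\<^esub> y" using that(1) by (auto simp: r_coset_def)
      then show ?thesis by (simp only: absorb[OF that(2)])
    qed
    have i: "inv\<^bsub>SL2\<^esub> y \<in> B" if "y \<in> B" for y using cl[OF one_D[OF D] that] by simp
    have "subgroup B SL2"
    proof (rule SL2.subgroupI)
      fix a b assume ab: "a \<in> B" "b \<in> B"
      then have "a ** inv\<^bsub>SL2\<^esub> (inv\<^bsub>SL2\<^esub> b) \<in> B" using cl i by blast
      then show "a \<otimes>\<^bsub>SL2\<^esub> b \<in> B" using ab D_subset[OF D] by auto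
    qed (use D_subset[OF D] one_D[OF D] i in auto)
    then have "B = S" using long_block_subgroup[OF B(1) one_G] rcoset_one[OF D_subset[OF D]] by simp
    then show False using \<open>B \<noteq> S\<close> by simp
  qed
  then show ?thesis using that B by blast
qed

end

section \<open>Parity of finite sets with an involution\<close>

lemma even_card_fixpoint_free_involution:
  assumes "finite A" "\<And>x. x \<in> A \<Longrightarrow> \<sigma> x \<in> A \<and> \<sigma> (\<sigma> x) = x \<and> \<sigma> x \<noteq> x"
  shows "even (card A)"
  using assms
proof (induction "card A" arbitrary: A rule: less_induct)
  case less
  show ?case
  proof (cases "A = {}")
    case False
    then obtain x where x: "x \<in> A" by blast
    let ?B = "A - {x, \<sigma> x}"
    have sub: "{x, \<sigma> x} \<subseteq> A" "card {x, \<sigma> x} = 2" using x less.prems(2)[OF x] by auto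
    then have card: "card ?B = card A - 2" "card A \<ge> 2"
      using less.prems(1) card_mono[OF less.prems(1) sub(1)] by (simp_all add: card_Diff_subset)
    moreover have "even (card ?B)"
    proof (rule less.hyps)
      fix y assume "y \<in> ?B"
      then show "\<sigma> y \<in> ?B \<and> \<sigma> (\<sigma> y) = y \<and> \<sigma> y \<noteq> y" using less.prems(2) x by (metis Diff_iff insert_iff singletonD)
    qed (use card less.prems(1) in auto)
    ultimately show ?thesis by simp
  qed simp
qed

text \<open>Everything except \<open>a\<close> is paired off. The element \<open>a\<close> need not
  belong to \<open>A\<close>; whether it does decides the parity.\<close>

lemma odd_card_iff_fixpoint:
  assumes "finite A" "\<And>x. x \<in> A \<Longrightarrow> \<sigma> x \<in> A \<and> \<sigma> (\<sigma> x) = x"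
    and "\<And>x. x \<in> A \<Longrightarrow> \<sigma> x = x \<longleftrightarrow> x = a"
  shows "odd (card A) \<longleftrightarrow> a \<in> A"
proof -
  have "even (card (A - {a}))"
    by (rule even_card_fixpoint_free_involution[where \<sigma> = \<sigma>]) (use assms in auto, metis)
  then show ?thesis using assms(1) by (cases "a \<in> A") (auto simp: card_Diff_singleton card_gt_0_iff)
qed

section \<open>The orbit of the block at infinity\<close>

text \<open>The assumption to be refuted: the results of this locale lead to
  \<open>False\<close>.\<close>

locale moved_flat_unital = flat_unital +
  fixes f0
  assumes f0: "f0 \<in> auts" "f0 ` Inft \<noteq> Inft"
begin

definition sb :: "'a^2^2 \<Rightarrow> 'a upoint set" where
  "sb g = Affine ` (S #>\<^bsub>SL2\<^esub> g)"

definition Omega :: "'a upoint set set" where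
  "Omega = (\<lambda>f. f ` Inft) ` auts"

lemma Affine_mem_sb: "g \<in> G \<Longrightarrow> x \<in> G \<Longrightarrow> Affine x \<in> sb g \<longleftrightarrow> x ** inv\<^bsub>SL2\<^esub> g \<in> S"
  using mem_rcoset_iff[OF S_subset] by (auto simp: sb_def)

lemma self_mem_sb: "g \<in> G \<Longrightarrow> Affine g \<in> sb g"
  by (simp add: Affine_mem_sb)

lemma sb_eq_iff: assumes "g \<in> G" "h \<in> G" shows "sb g = sb h \<longleftrightarrow> g ** inv\<^bsub>SL2\<^esub> h \<in> S"
proof
  assume "sb g = sb h"
  then show "g ** inv\<^bsub>SL2\<^esub> h \<in> S" using self_mem_sb[OF assms(1)] Affine_mem_sb assms by simp
next
  assume "g ** inv\<^bsub>SL2\<^esub> h \<in> S"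
  then have "g \<in> S #>\<^bsub>SL2\<^esub> h" using mem_rcoset_iff[OF S_subset] assms by simp
  then show "sb g = sb h" unfolding sb_def using subgroup_rcoset_eq[OF subgroup_S assms(2)] by simp
qed

lemma sb_neq_Inft: "g \<in> G \<Longrightarrow> sb g \<noteq> Inft"
  using self_mem_sb by fastforce

lemma rmul_sb: "g \<in> G \<Longrightarrow> h \<in> G \<Longrightarrow> rmul h ` sb g = sb (g ** h)"
  by (simp add: sb_def rmul_image_Affine S_subset)

lemma auts_Omega: "f \<in> auts \<Longrightarrow> X \<in> Omega \<Longrightarrow> f ` X \<in> Omega"
proof -
  assume f: "f \<in> auts" "X \<in> Omega"
  then obtain g where g: "g \<in> auts" "X = g ` Inft" by (auto simp: Omega_def)
  then have "f ` X = (f \<circ> g) ` Inft" by (simp only: image_comp)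
  then show ?thesis unfolding Omega_def using f g by blast
qed

text \<open>\<open>f0\<close> takes \<open>Inft\<close> to one coset of \<open>S\<close>, and right
  multiplications move this coset to all others.\<close>

lemma Omega_eq: "Omega = insert Inft (sb ` G)"
proof
  show "Omega \<subseteq> insert Inft (sb ` G)"
  proof
    fix X assume "X \<in> Omega"
    then obtain f where f: "f \<in> auts" "X = f ` Inft" by (auto simp: Omega_def)
    show "X \<in> insert Inft (sb ` G)"
    proof (cases "X = Inft")
      case False
      then obtain g where "g \<in> G" "X = Affine ` (S #>\<^bsub>SL2\<^esub> g)" using Inft_image_cases f by metis
      then show ?thesis by (auto simp: sb_def)
    qed simp
  qed
  have I: "Inft \<in> Omega" unfolding Omega_def
    by (rule image_eqI[where x = "rmul (mat 1)"]) (use rmul_auts[OF one_G] in auto)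
  obtain g0 where g0: "g0 \<in> G" "f0 ` Inft = sb g0" using Inft_image_cases[OF f0] by (auto simp: sb_def)
  have "sb g \<in> Omega" if "g \<in> G" for g
  proof -
    have "sb g = rmul (inv\<^bsub>SL2\<^esub> g0 ** g) ` f0 ` Inft"
      using g0 that by (simp add: rmul_sb SL2_mult_closed)
    then show ?thesis using auts_Omega[OF rmul_auts auts_Omega[OF f0(1) I]] that g0 by (simp add: SL2_mult_closed)
  qed
  then show "insert Inft (sb ` G) \<subseteq> Omega" using I by blast
qed

lemma Omega_memb [simp]: "Inft \<in> Omega" "g \<in> G \<Longrightarrow> sb g \<in> Omega"
  by (auto simp: Omega_eq)

lemma Omega_disjoint: "B \<in> Omega \<Longrightarrow> C \<in> Omega \<Longrightarrow> x \<in> B \<Longrightarrow> x \<in> C \<Longrightarrow> B = C"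
  unfolding Omega_def using Inft_images_disjoint by blast

text \<open>Some automorphism moves \<open>Inft\<close> to \<open>B\<close>, and right
  multiplications fix \<open>Inft\<close> while being transitive on the rest of the orbit.\<close>

lemma two_transitive:
  assumes "B \<in> Omega" "C \<in> Omega" "B \<noteq> C"
  obtains f where "f \<in> auts" "f ` Inft = B" "f ` sb (mat 1) = C"
proof -
  obtain f1 where f1: "f1 \<in> auts" "B = f1 ` Inft" using assms by (auto simp: Omega_def)
  have "finv f1 ` C \<in> Omega" using assms f1 by (intro auts_Omega) auto
  moreover have "finv f1 ` C \<noteq> Inft" using assms f1 by (metis auts_inv_simps(3))
  ultimately obtain g where g: "g \<in> G" "finv f1 ` C = sb g" by (auto simp: Omega_eq)
  have "(f1 \<circ> rmul g) ` Inft = B" using f1 by (simp only: image_comp[symmetric] rmul_image_Inft)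
  moreover have "(f1 \<circ> rmul g) ` sb (mat 1) = C"
    using f1 g by (simp only: image_comp[symmetric] rmul_sb one_G matrix_mul_lid) (metis auts_inv_simps(3))
  ultimately show ?thesis using that f1 g by blast
qed

lemma card_cosets_S: "card (sb ` G) = CARD('a) * (CARD('a) - 1)"
proof -
  have "sb ` G = (`) Affine ` (rcosets\<^bsub>SL2\<^esub> S)" by (auto simp: sb_def RCOSETS_def)
  moreover have "inj_on ((`) Affine) (rcosets\<^bsub>SL2\<^esub> S)"
    by (intro inj_onI) (metis (no_types) inj_image_eq_iff inj_onI upoint.inject(1))
  ultimately have c: "card (sb ` G) = card (rcosets\<^bsub>SL2\<^esub> S)" by (simp add: card_image)
  have "card (rcosets\<^bsub>SL2\<^esub> S) * card S = order (SL2 :: ('a^2^2) monoid)"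
    by (rule SL2.lagrange[OF subgroup_S])
  also have "\<dots> = CARD('a) * (CARD('a) - 1) * (CARD('a) + 1)"
  proof -
    have "x^2 - 1 = (x - 1) * (x + 1)" for x :: nat by (cases x) (auto simp: power2_eq_square)
    then show ?thesis unfolding order_def card_SL2 by (simp only: mult.assoc)
  qed
  finally show ?thesis unfolding c card_S by (metis Suc_eq_plus1 mult_right_cancel nat.distinct(1))
qed

subsection \<open>Odd characteristic\<close>

lemma neg_one_G [simp]: "mat (- 1) \<in> G"
  by (rule neg_one_SL2)

lemma neg_one_commute: "mat (- 1) ** g = g ** mat (- 1)" for g :: "'a^2^2"
  by (simp add: mat2_eq_iff matrix_mult_2 mat_def)

text \<open>By condition (Q) there are as many quotients as ordered pairs of distinct
  elements.\<close>

lemma inj_on_quotient: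
  assumes D: "D \<in> \<D>"
  shows "inj_on (\<lambda>(x, y). x ** inv\<^bsub>SL2\<^esub> y) {(x, y). x \<in> D \<and> y \<in> D \<and> x \<noteq> y}"
proof (rule eq_card_imp_inj_on)
  have eq: "{(x, y). x \<in> D \<and> y \<in> D \<and> x \<noteq> y} = (SIGMA x:D. D - {x})" by auto
  have "card (SIGMA x:D. D - {x}) = (\<Sum>x\<in>D. card (D - {x}))" by (rule card_SigmaI) auto
  also have "\<dots> = (\<Sum>x\<in>D. CARD('a))" using card_D[OF D] by (intro sum.cong) (auto simp: card_Diff_singleton)
  finally have "card {(x, y). x \<in> D \<and> y \<in> D \<and> x \<noteq> y} = (CARD('a) + 1) * CARD('a)"
    unfolding eq using card_D[OF D] by simp
  moreover have "(\<lambda>(x, y). x ** inv\<^bsub>SL2\<^esub> y) ` {(x, y). x \<in> D \<and> y \<in> D \<and> x \<noteq> y} = quotients SL2 D"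
    by (auto simp: quotients_def image_iff)
  ultimately show "card ((\<lambda>(x, y). x ** inv\<^bsub>SL2\<^esub> y) ` {(x, y). x \<in> D \<and> y \<in> D \<and> x \<noteq> y}) =
      card {(x, y). x \<in> D \<and> y \<in> D \<and> x \<noteq> y}"
    using card_quotients[OF D] by (simp add: algebra_simps)
qed simp

text \<open>By condition (P) the alternative is \<open>- 1 = x y^-1\<close> for distinct
  \<open>x\<close>, \<open>y\<close> in some \<open>D\<close>. Taking inverses gives
  \<open>- 1 = y x^-1\<close>, against the injectivity of quotients.\<close>

lemma neg_one_in_S: assumes odd: "(2::'a) \<noteq> 0" shows "mat (- 1) \<in> S"
proof (rule ccontr)
  assume "mat (- 1) \<notin> S"
  moreover have "mat (- 1) \<in> G - {mat 1}" using neg_one_SL2 neg_one_neq_one[OF odd] by simp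
  moreover have "mat (- 1) \<notin> T" if "T \<in> sylow_subgroups p SL2" for T :: "('a^2^2) set"
    using that neg_one_notin_stab[OF odd] by (auto simp: sylow_subgroups_eq)
  ultimately obtain D where D: "D \<in> \<D>" "mat (- 1) \<in> quotients SL2 D"
    unfolding covering[symmetric] by blast
  then obtain x y where xy: "x \<in> D" "y \<in> D" "x \<noteq> y" "mat (- 1) = x ** inv\<^bsub>SL2\<^esub> y" by (auto simp: quotients_def)
  then have G: "x \<in> G" "y \<in> G" using D_subset[OF D(1)] by auto
  have "y ** inv\<^bsub>SL2\<^esub> x = inv\<^bsub>SL2\<^esub> (x ** inv\<^bsub>SL2\<^esub> y)"
    using SL2.inv_mult_group[of x "inv\<^bsub>SL2\<^esub> y"] G by simp
  also have "\<dots> = mat (- 1)"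
    unfolding xy(4)[symmetric] using neg_one_SL2 neg_one_square by (intro SL2.inv_equality) auto
  finally have "x ** inv\<^bsub>SL2\<^esub> y = y ** inv\<^bsub>SL2\<^esub> x" using xy(4) by simp
  then have "(x, y) = (y, x)" using inj_onD[OF inj_on_quotient[OF D(1)], of "(x, y)" "(y, x)"] xy by simp
  then show False using xy by simp
qed

text \<open>\<open>cent f\<close> is the unique involution in the pointwise stabiliser of \<open>f ` Inft\<close>.\<close>

definition cent :: "('a upoint \<Rightarrow> 'a upoint) \<Rightarrow> 'a upoint \<Rightarrow> 'a upoint" where
  "cent f = f \<circ> rmul (mat (- 1)) \<circ> finv f"

lemma cent_auts: "f \<in> auts \<Longrightarrow> cent f \<in> auts"
  unfolding cent_def using neg_one_SL2 by (intro auts_comp auts_inv rmul_auts)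

lemma rmul_neg_one_invol: "rmul (mat (- 1)) (rmul (mat (- 1)) x) = x"
  using fun_cong[OF rmul_comp[OF neg_one_SL2 neg_one_SL2], of x] by (simp add: neg_one_square rmul_one)

lemma cent_invol: "f \<in> auts \<Longrightarrow> cent f (cent f x) = x"
  by (simp add: cent_def rmul_neg_one_invol)

lemma cent_fixes: "f \<in> auts \<Longrightarrow> x \<in> f ` Inft \<Longrightarrow> cent f x = x"
  by (auto simp: cent_def)

lemma cent_moves:
  assumes "(2::'a) \<noteq> 0" "f \<in> auts" "x \<in> flat_points p" "cent f x = x"
  shows "x \<in> f ` Inft"
proof (rule ccontr)
  assume "x \<notin> f ` Inft"
  then have "finv f x \<notin> Inft" using assms by simp
  moreover have "finv f x \<in> flat_points p" by (rule auts_points[OF auts_inv[OF assms(2)] assms(3)])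
  ultimately obtain y where y: "y \<in> G" "finv f x = Affine y" unfolding flat_points_eq by blast
  have "rmul (mat (- 1)) (finv f x) = finv f x"
    using assms(2,4) by (metis cent_def auts_inv_simps(2) comp_apply)
  then have "mat (- 1) = (mat 1 :: 'a^2^2)" using y neg_one_SL2 by (metis rmul_fixes_Affine)
  then show False using neg_one_neq_one assms(1) by blast
qed

lemma finv_comp: "f \<in> auts \<Longrightarrow> g \<in> auts \<Longrightarrow> finv (f \<circ> g) = finv g \<circ> finv f"
  by (rule o_inv_distrib) (auto intro: auts_bij)

lemma finv_finv: "f \<in> auts \<Longrightarrow> finv (finv f) = f"
  by (rule inv_inv_eq) (rule auts_bij)

lemma cent_comp: "f \<in> auts \<Longrightarrow> g \<in> auts \<Longrightarrow> cent (g \<circ> f) = g \<circ> cent f \<circ> finv g"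
  by (simp add: cent_def finv_comp o_assoc)

text \<open>\<open>cent h\<close> fixes \<open>Inft\<close> pointwise, so it is right multiplication
  by an involution, and \<open>mat (- 1)\<close> is the only one.\<close>

lemma cent_stabiliser:
  assumes odd: "(2::'a) \<noteq> 0" and h: "h \<in> auts" "h ` Inft = Inft"
  shows "cent h = rmul (mat (- 1))"
proof -
  obtain k where k: "k \<in> G" "cent h = rmul k"
    by (rule fixes_Inft_imp_rmul[OF cent_auts[OF h(1)]]) (use cent_fixes[OF h(1)] h(2) in auto)
  have "rmul k (rmul k (Affine (mat 1))) = Affine (mat 1)" using cent_invol[OF h(1)] k by metis
  then have "k ** k = mat 1" using k by simp
  moreover have "k \<noteq> mat 1"
  proof
    assume "k = mat 1"
    then have "cent h (Affine (mat 1)) = Affine (mat 1)" using k by simp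
    then have "Affine (mat 1) \<in> Inft" using cent_moves[OF odd h(1), of "Affine (mat 1)"] h(2) by (auto simp: flat_points_eq)
    then show False by simp
  qed
  ultimately have "k = mat (- 1)" using involution_odd_char[OF odd k(1)] by blast
  then show ?thesis using k by simp
qed

text \<open>\<open>f\<close> and \<open>g\<close> differ by an automorphism leaving
  \<open>Inft\<close> invariant, and such automorphisms commute with
  \<open>rmul (mat (- 1))\<close>.\<close>

lemma cent_eq:
  assumes odd: "(2::'a) \<noteq> 0" and fg: "f \<in> auts" "g \<in> auts" "f ` Inft = g ` Inft"
  shows "cent f = cent g"
proof -
  let ?h = "finv g \<circ> f"
  have h: "?h \<in> auts" using fg by auto
  have "?h ` Inft = Inft" unfolding image_comp[symmetric] fg(3) using fg(2) by simp
  then have "cent ?h = rmul (mat (- 1))" by (rule cent_stabiliser[OF odd h])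
  moreover have "f = g \<circ> ?h" using fg by (auto simp: fun_eq_iff)
  ultimately show ?thesis using cent_comp[OF h fg(2)] by (simp add: cent_def)
qed

text \<open>As \<open>mat (- 1)\<close> is central and lies in \<open>S\<close>, right
  multiplication by it maps each \<open>S g\<close> to itself; conjugation by \<open>f\<close>
  carries this over to \<open>cent f\<close>.\<close>

lemma cent_Omega:
  assumes odd: "(2::'a) \<noteq> 0" and f: "f \<in> auts" and X: "X \<in> Omega"
  shows "cent f ` X = X"
proof -
  have "rmul (mat (- 1)) ` sb g = sb g" if "g \<in> G" for g
  proof -
    have "(g ** mat (- 1)) ** inv\<^bsub>SL2\<^esub> g = mat (- 1)"
      using that by (simp add: neg_one_commute[symmetric] matrix_mul_assoc[symmetric])
    then show ?thesis using that neg_one_in_S[OF odd]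
      by (simp add: rmul_sb sb_eq_iff SL2_mult_closed)
  qed
  then have "rmul (mat (- 1)) ` Y = Y" if "Y \<in> Omega" for Y using that by (auto simp: Omega_eq)
  then have "rmul (mat (- 1)) ` finv f ` X = finv f ` X" using auts_Omega[OF auts_inv[OF f] X] by blast
  then show ?thesis unfolding cent_def image_comp[symmetric] using f by simp
qed

text \<open>A right multiplication moves one image to the other, so it conjugates
  \<open>cent f\<close> to \<open>cent g\<close>; it fixes \<open>Inft\<close> pointwise.\<close>

lemma cent_agree_Inft:
  assumes odd: "(2::'a) \<noteq> 0" and f: "f \<in> auts" "f ` Inft \<noteq> Inft" and g: "g \<in> auts" "g ` Inft \<noteq> Inft"
    and x: "x \<in> Inft"
  shows "cent f x = cent g x"
proof -
  obtain a b where a: "a \<in> G" "f ` Inft = sb a" and b: "b \<in> G" "g ` Inft = sb b"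
    using Inft_image_cases[OF f] Inft_image_cases[OF g] unfolding sb_def by metis
  let ?r = "rmul (inv\<^bsub>SL2\<^esub> a ** b)"
  have r: "?r \<in> auts" using a b by (intro rmul_auts SL2_mult_closed) auto
  have "(?r \<circ> f) ` Inft = g ` Inft"
    unfolding image_comp[symmetric] a b using a b by (simp add: rmul_sb SL2_mult_closed)
  then have "cent g = cent (?r \<circ> f)" using cent_eq[OF odd auts_comp[OF r f(1)] g(1)] by simp
  then have eq: "cent g = ?r \<circ> cent f \<circ> finv ?r" by (simp only: cent_comp[OF f(1) r])
  have "finv ?r x = x" using auts_inv_simps(2)[OF r, of x] x by simp
  moreover have "cent f x \<in> Inft" using cent_Omega[OF odd f(1) Omega_memb(1)] x by blast
  ultimately show ?thesis by (simp add: eq)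
qed

lemma cent_agree:
  assumes odd: "(2::'a) \<noteq> 0" and f: "f \<in> auts" "f ` Inft \<noteq> h ` Inft" and g: "g \<in> auts" "g ` Inft \<noteq> h ` Inft"
    and h: "h \<in> auts" and x: "x \<in> h ` Inft"
  shows "cent f x = cent g x"
proof -
  have ne: "(finv h \<circ> k) ` Inft \<noteq> Inft" if "k ` Inft \<noteq> h ` Inft" for k
    unfolding image_comp[symmetric] using that h by (metis auts_inv_simps(3))
  obtain y where y: "y \<in> Inft" "x = h y" using x by blast
  have hi: "finv h \<in> auts" using h by auto
  have "cent (finv h \<circ> f) y = cent (finv h \<circ> g) y"
    using hi f g ne y by (intro cent_agree_Inft[OF odd]) auto
  then have "finv h (cent f x) = finv h (cent g x)"
    using f g h hi y by (simp add: cent_comp finv_finv)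
  then show ?thesis using h by simp
qed

text \<open>For three cosets \<open>B\<close>, \<open>C\<close>, \<open>D\<close> of
  \<open>S\<close>, the involutions of \<open>B\<close> and \<open>C\<close> agree on
  \<open>Inft\<close> and on \<open>D\<close>. Their product fixes \<open>Inft\<close> pointwise and
  a point of \<open>D\<close>, so it is the identity. But then they coincide, although their fixed
  points form different blocks.\<close>

lemma even_characteristic: "(2::'a) = 0"
proof (rule ccontr)
  assume odd: "(2::'a) \<noteq> 0"
  have "3 * 2 \<le> CARD('a) * (CARD('a) - 1)" using card_ge_3 by (intro mult_le_mono) auto
  then have "3 \<le> card (sb ` G)" using card_cosets_S by simp
  then obtain Z where Z: "Z \<subseteq> sb ` G" "card Z = 3" by (rule obtain_subset_with_card_n)
  then obtain B C D where BCD: "Z = {B, C, D}" "B \<noteq> C" "B \<noteq> D" "C \<noteq> D" by (auto simp: card_3_iff)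
  then have mem: "B \<in> sb ` G" "C \<in> sb ` G" "D \<in> sb ` G" using Z by auto
  then have "B \<in> Omega" "C \<in> Omega" "D \<in> Omega" by (auto simp: Omega_eq)
  then obtain fB fC fD where f: "fB \<in> auts" "B = fB ` Inft" "fC \<in> auts" "C = fC ` Inft" "fD \<in> auts" "D = fD ` Inft"
    unfolding Omega_def by blast
  have neI: "B \<noteq> Inft" "C \<noteq> Inft" using mem sb_neq_Inft by auto
  have Inft: "cent fB (cent fC x) = x" if x: "x \<in> Inft" for x
  proof -
    have "cent fC x \<in> Inft" using cent_Omega[OF odd f(3) Omega_memb(1)] x by blast
    then have "cent fB (cent fC x) = cent fC (cent fC x)" using f neI by (intro cent_agree_Inft[OF odd]) auto
    then show ?thesis using cent_invol f by simp
  qed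
  obtain k where k: "k \<in> G" "cent fB \<circ> cent fC = rmul k"
    by (rule fixes_Inft_imp_rmul[OF auts_comp[OF cent_auts[OF f(1)] cent_auts[OF f(3)]]]) (use Inft in auto)
  obtain d where d: "d \<in> G" "D = sb d" using mem by blast
  have dD: "Affine d \<in> D" using d self_mem_sb by simp
  have "cent fC (Affine d) \<in> D" using cent_Omega[OF odd f(3) \<open>D \<in> Omega\<close>] dD by blast
  then have "cent fB (cent fC (Affine d)) = cent fC (cent fC (Affine d))"
    using f BCD by (intro cent_agree[OF odd, of _ fD]) auto
  then have "cent fB (cent fC (Affine d)) = Affine d" using cent_invol f by simp
  then have "rmul k (Affine d) = Affine d" using fun_cong[OF k(2), of "Affine d"] by simp
  then have "k = mat 1" using rmul_fixes_Affine k d by blast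
  then have id: "cent fB (cent fC x) = x" for x using fun_cong[OF k(2), of x] by (simp add: rmul_one)
  obtain b where b: "b \<in> G" "B = sb b" using mem by blast
  have bB: "Affine b \<in> B" using b self_mem_sb by simp
  have "cent fC (Affine b) = cent fB (Affine b)" using id[of "Affine b"] cent_invol[OF f(1)] by metis
  also have "\<dots> = Affine b" using cent_fixes f bB by blast
  finally have "Affine b \<in> C" using cent_moves[OF odd f(3), of "Affine b"] f b by (auto simp: flat_points_eq)
  then show False using Omega_disjoint[OF \<open>B \<in> Omega\<close> \<open>C \<in> Omega\<close> bB] BCD by blast
qed

subsection \<open>Even characteristic\<close>

definition Invol :: "('a^2^2) set" where
  "Invol = {t \<in> G. t \<noteq> mat 1 \<and> t ** t = mat 1}"

lemma Invol_G: "t \<in> Invol \<Longrightarrow> t \<in> G" and Invol_square: "t \<in> Invol \<Longrightarrow> t ** t = mat 1"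
  and Invol_neq_one: "t \<in> Invol \<Longrightarrow> t \<noteq> mat 1"
  by (auto simp: Invol_def)

lemma Invol_stab: assumes "t \<in> Invol" obtains v where "v \<noteq> 0" "t \<in> stab v"
  using involution_in_stab[OF even_characteristic Invol_G[OF assms] Invol_square[OF assms]] by blast

lemma conj_Invol: assumes "t \<in> Invol" "g \<in> G" shows "g ** t ** inv\<^bsub>SL2\<^esub> g \<in> Invol"
proof -
  have t: "t \<in> G" "t \<noteq> mat 1" "t ** t = mat 1" using assms by (auto simp: Invol_def)
  have "(g ** t ** inv\<^bsub>SL2\<^esub> g) ** (g ** t ** inv\<^bsub>SL2\<^esub> g) = g ** (t ** t) ** inv\<^bsub>SL2\<^esub> g"
    using assms(2) by (simp add: matrix_mul_assoc[symmetric])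
  also have "\<dots> = mat 1" using t assms by simp
  finally have "(g ** t ** inv\<^bsub>SL2\<^esub> g) ** (g ** t ** inv\<^bsub>SL2\<^esub> g) = mat 1" .
  moreover have "g ** t ** inv\<^bsub>SL2\<^esub> g \<noteq> mat 1"
  proof
    assume a: "g ** t ** inv\<^bsub>SL2\<^esub> g = mat 1"
    have "t = inv\<^bsub>SL2\<^esub> g ** (g ** t ** inv\<^bsub>SL2\<^esub> g) ** g"
      using assms(2) by (simp add: matrix_mul_assoc[symmetric])
    then show False using t assms unfolding a by simp
  qed
  ultimately show ?thesis using t assms by (simp add: Invol_def SL2_mult_closed)
qed

lemma Invol_notin_S: "t \<in> Invol \<Longrightarrow> t \<notin> S"
  using S_inter_stab Invol_neq_one by (metis Invol_stab)

lemma card_Invol_ge: "CARD('a)^2 - 1 \<le> card Invol"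
proof -
  \<comment> \<open>\<open>T v\<close> is the transvection taking \<open>x\<close> to
    \<open>x + (dt v x) v\<close>. It determines \<open>v\<close> because squaring is injective in
    characteristic 2.\<close>
  define T :: "'a^2 \<Rightarrow> 'a^2^2" where
    "T v = vector [vector [1 - v$1 * v$2, v$1 * v$1], vector [- (v$2 * v$2), 1 + v$1 * v$2]]" for v
  have sq: "a = b" if "a * a = b * b" for a b :: 'a
  proof -
    have "(a - b) * (a - b) = a * a + b * b - 2 * (a * b)" by (simp add: algebra_simps)
    also have "\<dots> = 2 * (b * b) - 2 * (a * b)" using that by simp
    also have "\<dots> = 0" unfolding even_characteristic by simp
    finally show ?thesis by simp
  qed
  have "inj_on T (UNIV - {0})"
    by (intro inj_onI) (auto simp: T_def mat2_eq_iff vec2_eq_iff intro: sq)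
  moreover have "T ` (UNIV - {0}) \<subseteq> Invol"
  proof
    fix t assume "t \<in> T ` (UNIV - {0})"
    then obtain v where v: "v \<noteq> 0" "t = T v" by auto
    have "det t = 1" by (simp add: v T_def det_2 algebra_simps)
    moreover have "t *v v = v" by (simp add: v T_def matrix_vector_mult_2 vec2_eq_iff algebra_simps)
    ultimately have "t \<in> stab v" by (simp add: stab_def carrier_SL2)
    then have "t ** t = mat 1" by (rule stab_involution[OF even_characteristic v(1)])
    moreover have "t \<noteq> mat 1" using v by (auto simp: T_def mat2_eq_iff mat_def vec2_eq_iff)
    ultimately show "t \<in> Invol" using \<open>det t = 1\<close> by (simp add: Invol_def carrier_SL2)
  qed
  ultimately have "card (UNIV - {0::'a^2}) \<le> card Invol" by (intro card_inj_on_le) auto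
  then show ?thesis by (simp add: card_Diff_singleton)
qed

text \<open>Every such \<open>t\<close> inverts \<open>s\<close>. If two of them fixed the same
  \<open>v\<close>, their product would fix \<open>v\<close> and \<open>s v\<close>; then
  \<open>s v\<close> is a multiple of \<open>v\<close>, and \<open>s\<close> fixes \<open>v\<close>,
  which is impossible in \<open>S\<close>. So each of the \<open>q + 1\<close> stabilisers contains
  at most one.\<close>

lemma card_Invol_pairs_le:
  assumes s: "s \<in> S" "s \<noteq> mat 1"
  shows "card {t \<in> Invol. s ** t \<in> Invol} \<le> CARD('a) + 1"
proof -
  let ?I = "{t \<in> Invol. s ** t \<in> Invol}"
  \<comment> \<open>Representatives of the \<open>q + 1\<close> lines through 0.\<close>
  define R :: "('a^2) set" where "R = insert (vector [0, 1]) (range (\<lambda>c. vector [1, c]))"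
  have sG: "s \<in> G" using s S_subset by auto
  have inverts: "t ** s ** t = inv\<^bsub>SL2\<^esub> s" if "t \<in> ?I" for t
  proof -
    have st: "(s ** t) ** (s ** t) = mat 1" and tG: "t \<in> G" using that by (auto simp: Invol_def)
    have "(t ** s ** t) ** s = t ** ((s ** t) ** (s ** t)) ** inv\<^bsub>SL2\<^esub> t"
      using tG by (simp add: matrix_mul_assoc)
    also have "\<dots> = mat 1" using tG unfolding st by simp
    finally show ?thesis using sG tG by (intro SL2.inv_equality[symmetric]) (auto intro: SL2_mult_closed)
  qed
  have uniq: "t = t'" if t: "t \<in> ?I" "t' \<in> ?I" "t \<in> stab v" "t' \<in> stab v" and v: "v \<noteq> 0" for t t' v
  proof (rule ccontr)
    assume ne: "t \<noteq> t'"
    have tv: "t *v v = v" "t' *v v = v" and G: "t \<in> G" "t' \<in> G" using t by (auto simp: stab_def)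
    have sq: "t ** t = mat 1" "t' ** t' = mat 1" using t Invol_square by auto
    have "t' ** inv\<^bsub>SL2\<^esub> s ** t' = (t' ** t') ** s ** (t' ** t')"
      unfolding inverts[OF t(2), symmetric] by (simp add: matrix_mul_assoc)
    then have s2: "t' ** inv\<^bsub>SL2\<^esub> s ** t' = s" using sq by simp
    have "(t' ** t) *v (s *v v) = t' *v (t *v (s *v (t *v (t' *v v))))"
      using tv by (simp add: matrix_vector_mul_assoc[symmetric])
    also have "\<dots> = (t' ** (t ** s ** t) ** t') *v v" by (simp add: matrix_vector_mul_assoc matrix_mul_assoc)
    also have "\<dots> = s *v v" unfolding inverts[OF t(1)] s2 ..
    finally have ufix: "(t' ** t) *v (s *v v) = s *v v" .
    have "t' ** t \<noteq> mat 1"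
    proof
      assume "t' ** t = mat 1"
      then have "t' ** t ** t = t" by simp
      then show False using ne sq by (simp add: matrix_mul_assoc[symmetric])
    qed
    then have "dt v (s *v v) = 0"
      using matrix_eq_on_basis[of v "s *v v" "t' ** t" "mat 1"] ufix tv
      by (auto simp: matrix_vector_mul_assoc[symmetric])
    then obtain c where c: "s *v v = c *s v" using dt_eq_0_imp_multiple v by blast
    have "v = s *v (t *v (s *v (t *v v)))"
    proof -
      have "s *v ((t ** s ** t) *v v) = v" unfolding inverts[OF t(1)] using sG by simp
      then show ?thesis by (simp add: matrix_vector_mul_assoc[symmetric])
    qed
    also have "\<dots> = (c * c) *s v" using tv c by (simp add: vector_scalar_commute)
    finally have "(c * c - 1) *s v = 0" by (simp add: vector_sub_rdistrib)
    then have "c * c = 1" using v by (auto simp: vec2_eq_iff)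
    then have "(c - 1) * (c - 1) = 2 - 2 * c" by (simp add: algebra_simps)
    then have "c = 1" unfolding even_characteristic by simp
    then have "s \<in> stab v" using c sG by (simp add: stab_def)
    then show False using S_inter_stab[OF v s(1)] s(2) by blast
  qed
  have "?I \<subseteq> (\<Union>v\<in>R. ?I \<inter> stab v)"
  proof
    fix t assume t: "t \<in> ?I"
    then obtain v where v: "v \<noteq> 0" "t \<in> stab v" using Invol_stab by blast
    have tG: "t \<in> G" using v by (simp add: stab_def)
    have sc: "t \<in> stab (c *s v)" for c using v by (simp add: stab_def vector_scalar_commute)
    show "t \<in> (\<Union>v\<in>R. ?I \<inter> stab v)"
    proof (cases "v$1 = 0")
      case True
      then have "(1 / v$2) *s v = vector [0, 1]" using v by (auto simp: vec2_eq_iff)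
      then show ?thesis using sc[of "1 / v$2"] t by (auto simp: R_def)
    next
      case False
      then have "(1 / v$1) *s v = vector [1, v$2 / v$1]" by (auto simp: vec2_eq_iff)
      then show ?thesis using sc[of "1 / v$1"] t by (auto simp: R_def)
    qed
  qed
  then have "card ?I \<le> card (\<Union>v\<in>R. ?I \<inter> stab v)" by (intro card_mono) auto
  also have "\<dots> \<le> (\<Sum>v\<in>R. card (?I \<inter> stab v))" by (rule card_UN_le) simp
  also have "\<dots> \<le> (\<Sum>v\<in>R. 1)"
  proof (rule sum_mono)
    fix v assume "v \<in> R"
    then have "v \<noteq> 0" by (auto simp: R_def vec2_eq_iff)
    then show "card (?I \<inter> stab v) \<le> 1"
      using uniq[of _ _ v] by (subst card_le_Suc0_iff_eq[unfolded One_nat_def[symmetric]]) auto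
  qed
  also have "\<dots> = card R" by simp
  also have "\<dots> \<le> Suc (card (range (\<lambda>c::'a. vector [1, c] :: 'a^2)))" unfolding R_def by (rule card_insert_le_m1) auto
  also have "\<dots> \<le> CARD('a) + 1" using card_image_le[of UNIV "\<lambda>c::'a. vector [1, c] :: 'a^2"] by simp
  finally show ?thesis .
qed

section \<open>Involutions interchanging two images\<close>

definition swaps :: "'a upoint set \<Rightarrow> 'a upoint set \<Rightarrow> 'a upoint set \<Rightarrow> ('a upoint \<Rightarrow> 'a upoint) set" where
  "swaps X C D = {\<phi> \<in> auts. (\<forall>x\<in>X. \<phi> x = x) \<and> \<phi> \<circ> \<phi> = id \<and> \<phi> \<noteq> id \<and> \<phi> ` C = D}"

lemma swaps_commute: "swaps X C D = swaps X D C"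
proof -
  have "\<phi> ` D = C" if "\<phi> \<circ> \<phi> = id" "\<phi> ` C = D" for \<phi> :: "'a upoint \<Rightarrow> 'a upoint" and C D
  proof -
    have "\<phi> ` \<phi> ` C = C" unfolding image_comp that(1) by simp
    then show ?thesis using that(2) by simp
  qed
  then show ?thesis unfolding swaps_def by blast
qed

lemma swaps_conj_mem:
  assumes f: "f \<in> auts" and \<phi>: "\<phi> \<in> swaps X C D"
  shows "f \<circ> \<phi> \<circ> finv f \<in> swaps (f ` X) (f ` C) (f ` D)"
proof -
  have p: "\<phi> \<in> auts" "\<And>x. x \<in> X \<Longrightarrow> \<phi> x = x" "\<And>x. \<phi> (\<phi> x) = x" "\<phi> \<noteq> id" "\<phi> ` C = D"
    using \<phi> by (auto simp: swaps_def fun_eq_iff)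
  have "f \<circ> \<phi> \<circ> finv f \<noteq> id"
  proof
    assume a: "f \<circ> \<phi> \<circ> finv f = id"
    have "\<phi> x = x" for x using fun_cong[OF a, of "f x"] f by simp
    then show False using p(4) by (auto simp: fun_eq_iff)
  qed
  moreover have "(f \<circ> \<phi> \<circ> finv f) ` f ` C = f ` D"
    unfolding image_comp[symmetric] using f p(5) by simp
  ultimately show ?thesis using f p unfolding swaps_def by (auto simp: fun_eq_iff)
qed

lemma card_swaps_conj:
  assumes f: "f \<in> auts"
  shows "card (swaps (f ` X) (f ` C) (f ` D)) = card (swaps X C D)"
proof -
  have i: "finv f \<in> auts" using f by auto
  have "bij_betw (\<lambda>\<phi>. f \<circ> \<phi> \<circ> finv f) (swaps X C D) (swaps (f ` X) (f ` C) (f ` D))"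
  proof (rule bij_betw_byWitness[where f' = "\<lambda>\<phi>. finv f \<circ> \<phi> \<circ> f"])
    show "(\<lambda>\<phi>. f \<circ> \<phi> \<circ> finv f) ` swaps X C D \<subseteq> swaps (f ` X) (f ` C) (f ` D)"
      using swaps_conj_mem[OF f] by blast
    show "(\<lambda>\<phi>. finv f \<circ> \<phi> \<circ> f) ` swaps (f ` X) (f ` C) (f ` D) \<subseteq> swaps X C D"
      using swaps_conj_mem[OF i, of _ "f ` X" "f ` C" "f ` D"] f by (auto simp: finv_finv)
  qed (use f in \<open>auto simp: fun_eq_iff\<close>)
  then show ?thesis by (rule bij_betw_same_card[symmetric])
qed

text \<open>Automorphisms fixing \<open>Inft\<close> pointwise are right multiplications, so what is
  counted here are the involutions in \<open>S t\<close>.\<close>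

lemma card_swaps_Inft:
  assumes "t \<in> Invol"
  shows "card (swaps Inft (sb (mat 1)) (sb t)) = card {t' \<in> Invol. sb t' = sb t}"
proof -
  have "bij_betw rmul {t' \<in> Invol. sb t' = sb t} (swaps Inft (sb (mat 1)) (sb t))"
  proof (rule bij_betwI')
    fix x y assume "x \<in> {t' \<in> Invol. sb t' = sb t}" "y \<in> {t' \<in> Invol. sb t' = sb t}"
    have "x = y" if "rmul x = rmul y"
    proof -
      have "rmul x (Affine (mat 1)) = rmul y (Affine (mat 1))" by (simp only: that)
      then show ?thesis by simp
    qed
    then show "(rmul x = rmul y) = (x = y)" by auto
  next
    fix x assume "x \<in> {t' \<in> Invol. sb t' = sb t}"
    then have x: "x \<in> G" "x \<noteq> mat 1" "x ** x = mat 1" "sb x = sb t" by (auto simp: Invol_def)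
    have "rmul x \<noteq> id"
    proof
      assume "rmul x = id"
      then have "rmul x (Affine (mat 1)) = Affine (mat 1)" by simp
      then show False using x by simp
    qed
    moreover have "rmul x \<circ> rmul x = id" using x by (simp add: rmul_comp rmul_one)
    ultimately show "rmul x \<in> swaps Inft (sb (mat 1)) (sb t)"
      using x rmul_auts[OF x(1)] by (simp add: swaps_def rmul_sb)
  next
    fix \<phi> assume "\<phi> \<in> swaps Inft (sb (mat 1)) (sb t)"
    then have p: "\<phi> \<in> auts" "\<And>x. x \<in> Inft \<Longrightarrow> \<phi> x = x" "\<phi> \<circ> \<phi> = id" "\<phi> \<noteq> id" "\<phi> ` sb (mat 1) = sb t"
      by (auto simp: swaps_def)
    obtain k where k: "k \<in> G" "\<phi> = rmul k" by (rule fixes_Inft_imp_rmul[OF p(1,2)])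
    have "(rmul k \<circ> rmul k) (Affine (mat 1)) = Affine (mat 1)" using p(3) unfolding k(2) by simp
    then have "k ** k = mat 1" using k(1) by simp
    moreover have "k \<noteq> mat 1" using p(4) k(2) rmul_one by metis
    moreover have "sb k = sb t" using p(5) unfolding k(2) rmul_sb[OF one_G k(1)] by simp
    ultimately show "\<exists>x\<in>{t' \<in> Invol. sb t' = sb t}. \<phi> = rmul x" using k by (auto simp: Invol_def)
  qed
  then show ?thesis by (rule bij_betw_same_card[symmetric])
qed

text \<open>Sorting the possible axes \<open>X\<close> by the number \<open>n\<close> of swaps is
  compatible with automorphisms, and the parity of these sets will single out one value of
  \<open>n\<close>.\<close>

definition axes :: "'a upoint set \<Rightarrow> 'a upoint set \<Rightarrow> nat \<Rightarrow> 'a upoint set set" where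
  "axes C D n = {X \<in> Omega - {C, D}. card (swaps X C D) = n}"

lemma finite_Omega: "finite Omega"
  unfolding Omega_eq by simp

lemma axes_conj_subset:
  assumes f: "f \<in> auts"
  shows "(`) f ` axes C D n \<subseteq> axes (f ` C) (f ` D) n"
  using auts_Omega[OF f] card_swaps_conj[OF f] f by (auto simp: axes_def)

lemma card_axes_conj:
  assumes f: "f \<in> auts"
  shows "card (axes (f ` C) (f ` D) n) = card (axes C D n)"
proof -
  have le: "card (axes C D n) \<le> card (axes (f ` C) (f ` D) n)" if "f \<in> auts" for f C D
    using axes_conj_subset[OF that] that finite_Omega
    by (intro card_inj_on_le[where f = "(`) f"]) (auto simp: inj_on_def axes_def)
  have "finv f \<in> auts" using f by auto
  then have "card (axes (f ` C) (f ` D) n) \<le> card (axes (finv f ` f ` C) (finv f ` f ` D) n)" by (rule le)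
  then show ?thesis using le[OF f, of C D] f by simp
qed

text \<open>Right multiplication by \<open>t\<close> interchanges the two blocks, so it permutes the
  axes in pairs. An invariant \<open>S g\<close> would put the involution \<open>g t g^-1\<close>
  into \<open>S\<close>; only \<open>Inft\<close> is left to decide the parity.\<close>

lemma odd_card_axes:
  assumes t: "t \<in> Invol"
  shows "odd (card (axes (sb (mat 1)) (sb t) n)) \<longleftrightarrow> n = card {t' \<in> Invol. sb t' = sb t}"
proof -
  have tG: "t \<in> G" and tt: "t ** t = mat 1" using t by (auto simp: Invol_def)
  have swap: "rmul t ` sb (mat 1) = sb t" "rmul t ` sb t = sb (mat 1)"
    using tG tt by (simp_all add: rmul_sb)
  have "axes (sb t) (sb (mat 1)) n = axes (sb (mat 1)) (sb t) n"
    using swaps_commute by (auto simp: axes_def)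
  then have sub: "(`) (rmul t) ` axes (sb (mat 1)) (sb t) n \<subseteq> axes (sb (mat 1)) (sb t) n"
    using axes_conj_subset[OF rmul_auts[OF tG], of "sb (mat 1)" "sb t" n] swap by simp
  have "odd (card (axes (sb (mat 1)) (sb t) n)) \<longleftrightarrow> Inft \<in> axes (sb (mat 1)) (sb t) n"
  proof (rule odd_card_iff_fixpoint[where \<sigma> = "(`) (rmul t)"])
    fix X assume X: "X \<in> axes (sb (mat 1)) (sb t) n"
    have "rmul t ` rmul t ` X = X"
      unfolding image_comp rmul_comp[OF tG tG] tt rmul_one by simp
    then show "rmul t ` X \<in> axes (sb (mat 1)) (sb t) n \<and> rmul t ` rmul t ` X = X" using sub X by blast
    show "rmul t ` X = X \<longleftrightarrow> X = Inft"
    proof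
      assume a: "rmul t ` X = X"
      show "X = Inft"
      proof (rule ccontr)
        assume "X \<noteq> Inft"
        then obtain g where g: "g \<in> G" "X = sb g" using X by (auto simp: axes_def Omega_eq)
        then have "sb (g ** t) = sb g" using a tG by (simp add: rmul_sb)
        then have "g ** t ** inv\<^bsub>SL2\<^esub> g \<in> S" using g tG by (simp add: sb_eq_iff SL2_mult_closed)
        then show False using conj_Invol[OF t g(1)] Invol_notin_S by blast
      qed
    qed simp
  qed (use finite_Omega in \<open>simp add: axes_def\<close>)
  also have "\<dots> \<longleftrightarrow> n = card {t' \<in> Invol. sb t' = sb t}"
    using card_swaps_Inft[OF t] sb_neq_Inft[OF one_G] sb_neq_Inft[OF tG] by (auto simp: axes_def)
  finally show ?thesis .
qed

lemma sb_Invol_neq: assumes "t \<in> Invol" shows "sb t \<noteq> sb (mat 1)"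
  using sb_eq_iff[OF Invol_G[OF assms] one_G] Invol_notin_S[OF assms] by simp

text \<open>By double transitivity the number of axes for each \<open>n\<close> does not depend on
  \<open>t\<close>, and the fibre size is the only \<open>n\<close> for which this number is
  odd.\<close>

lemma card_fibre_const:
  assumes "t \<in> Invol" "u \<in> Invol"
  shows "card {t' \<in> Invol. sb t' = sb t} = card {t' \<in> Invol. sb t' = sb u}"
proof -
  have base: "card (axes (sb (mat 1)) (sb t) n) = card (axes Inft (sb (mat 1)) n)" if t: "t \<in> Invol" for t n
  proof -
    obtain f where "f \<in> auts" "f ` Inft = sb (mat 1)" "f ` sb (mat 1) = sb t"
      using two_transitive[of "sb (mat 1)" "sb t"] sb_Invol_neq[OF t] Invol_G[OF t] by (metis Omega_memb(2) one_G)
    then show ?thesis using card_axes_conj by metis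
  qed
  have "odd (card (axes (sb (mat 1)) (sb t) (card {t' \<in> Invol. sb t' = sb t})))"
    using odd_card_axes[OF assms(1)] by blast
  then have "odd (card (axes (sb (mat 1)) (sb u) (card {t' \<in> Invol. sb t' = sb t})))"
    using base assms by simp
  then show ?thesis using odd_card_axes[OF assms(2)] by blast
qed

lemma card_fibre_eq:
  assumes t: "t \<in> Invol"
  shows "card {t' \<in> Invol. sb t' = sb t} = card {s \<in> S. s ** t \<in> Invol}"
proof -
  have tG: "t \<in> G" using t Invol_G by blast
  have SG: "s \<in> G" if "s \<in> S" for s using that S_subset by blast
  have "bij_betw (\<lambda>s. s ** t) {s \<in> S. s ** t \<in> Invol} {t' \<in> Invol. sb t' = sb t}"
  proof (rule bij_betw_byWitness[where f' = "\<lambda>x. x ** inv\<^bsub>SL2\<^esub> t"])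
    show "(\<lambda>s. s ** t) ` {s \<in> S. s ** t \<in> Invol} \<subseteq> {t' \<in> Invol. sb t' = sb t}"
    proof
      fix x assume "x \<in> (\<lambda>s. s ** t) ` {s \<in> S. s ** t \<in> Invol}"
      then obtain s where "s \<in> S" "s ** t \<in> Invol" "x = s ** t" by auto
      then show "x \<in> {t' \<in> Invol. sb t' = sb t}" using sb_eq_iff[of x t] tG Invol_G[of x] by simp
    qed
    show "(\<lambda>x. x ** inv\<^bsub>SL2\<^esub> t) ` {t' \<in> Invol. sb t' = sb t} \<subseteq> {s \<in> S. s ** t \<in> Invol}"
    proof
      fix x assume "x \<in> (\<lambda>x. x ** inv\<^bsub>SL2\<^esub> t) ` {t' \<in> Invol. sb t' = sb t}"
      then obtain y where "y \<in> Invol" "sb y = sb t" "x = y ** inv\<^bsub>SL2\<^esub> t" by auto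
      then show "x \<in> {s \<in> S. s ** t \<in> Invol}" using sb_eq_iff[of y t] tG Invol_G[of y] by simp
    qed
  qed (use tG in auto)
  then show ?thesis by (rule bij_betw_same_card[symmetric])
qed

text \<open>Inversion acts on this set, since \<open>s^-1 t = t (s t) t^-1\<close> when
  \<open>t\<close> and \<open>s t\<close> are involutions. It fixes only \<open>mat 1\<close>,
  because \<open>S\<close> contains no involution.\<close>

lemma odd_fibre:
  assumes t: "t \<in> Invol"
  shows "odd (card {s \<in> S. s ** t \<in> Invol})"
proof -
  have tG: "t \<in> G" and tt: "t ** t = mat 1" using t by (auto simp: Invol_def)
  have ti: "inv\<^bsub>SL2\<^esub> t = t" using tt tG by (intro SL2.inv_equality) auto
  have SG: "s \<in> G" if "s \<in> S" for s using that S_subset by blast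
  have "odd (card {s \<in> S. s ** t \<in> Invol}) \<longleftrightarrow> mat 1 \<in> {s \<in> S. s ** t \<in> Invol}"
  proof (rule odd_card_iff_fixpoint[where \<sigma> = "\<lambda>s. inv\<^bsub>SL2\<^esub> s"])
    fix s assume "s \<in> {s \<in> S. s ** t \<in> Invol}"
    then have s: "s \<in> S" "s \<in> G" "s ** t \<in> Invol" using SG by auto
    have "(s ** t) ** (s ** t) = mat 1" using s Invol_square by blast
    then have i: "inv\<^bsub>SL2\<^esub> (s ** t) = s ** t" using s Invol_G by (intro SL2.inv_equality) auto
    have "inv\<^bsub>SL2\<^esub> s ** t = t ** (t ** inv\<^bsub>SL2\<^esub> s) ** t" using tt by (simp add: matrix_mul_assoc)
    also have "t ** inv\<^bsub>SL2\<^esub> s = s ** t" using SL2.inv_mult_group[OF s(2) tG] i ti by simp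
    finally have "inv\<^bsub>SL2\<^esub> s ** t = t ** (s ** t) ** inv\<^bsub>SL2\<^esub> t" using ti by simp
    then have "inv\<^bsub>SL2\<^esub> s ** t \<in> Invol" using conj_Invol[OF s(3) tG] by simp
    then show "inv\<^bsub>SL2\<^esub> s \<in> {s \<in> S. s ** t \<in> Invol} \<and> inv\<^bsub>SL2\<^esub> (inv\<^bsub>SL2\<^esub> s) = s"
      using subgroup.m_inv_closed[OF subgroup_S s(1)] s(2) by simp
    show "inv\<^bsub>SL2\<^esub> s = s \<longleftrightarrow> s = mat 1"
    proof
      assume "inv\<^bsub>SL2\<^esub> s = s"
      then have "s ** s = mat 1" using SL2_inv_mult(1)[OF s(2)] by simp
      then show "s = mat 1" using Invol_notin_S s by (auto simp: Invol_def)
    qed simp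
  qed simp
  then show ?thesis using t by simp
qed

lemma no_moved_flat_unital: False
proof -
  define q where "q = CARD('a)"
  have q: "q \<ge> 3" using card_ge_3 by (simp add: q_def)
  define n where "n = card Invol"
  have n: "q^2 - 1 \<le> n" using card_Invol_ge by (simp add: n_def q_def)
  have "q^2 \<ge> 9" using power_mono[OF q, of 2] by simp
  then have "card Invol \<noteq> 0" using n unfolding n_def by linarith
  then obtain t0 where t0: "t0 \<in> Invol" by fastforce
  define w where "w = card {s \<in> S. s ** t0 \<in> Invol}"
  have w: "card {s \<in> S. s ** t \<in> Invol} = w" if "t \<in> Invol" for t
    using card_fibre_const[OF that t0] card_fibre_eq[OF that] card_fibre_eq[OF t0] by (simp add: w_def)
  \<comment> \<open>Double counting of the pairs of \<open>s\<close> in \<open>S\<close> and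
    \<open>t\<close> such that \<open>t\<close> and \<open>s t\<close> are involutions:
    \<open>s = 1\<close> contributes \<open>n\<close>, each of the other \<open>q\<close> elements
    at most \<open>q + 1\<close>.\<close>
  have "n * w = (\<Sum>t\<in>Invol. card {s \<in> S. s ** t \<in> Invol})" using w by (simp add: n_def)
  also have "\<dots> = (\<Sum>t\<in>Invol. \<Sum>s\<in>S. if s ** t \<in> Invol then 1 else 0)"
    by (intro sum.cong refl) (simp add: sum.If_cases Int_def)
  also have "\<dots> = (\<Sum>s\<in>S. \<Sum>t\<in>Invol. if s ** t \<in> Invol then 1 else 0)" by (rule sum.swap)
  also have "\<dots> = (\<Sum>s\<in>S. card {t \<in> Invol. s ** t \<in> Invol})"
    by (intro sum.cong refl) (simp add: sum.If_cases Int_def)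
  also have "\<dots> = card {t \<in> Invol. mat 1 ** t \<in> Invol} + (\<Sum>s\<in>S - {mat 1}. card {t \<in> Invol. s ** t \<in> Invol})"
    by (rule sum.remove) auto
  also have "\<dots> \<le> n + (\<Sum>s\<in>S - {mat 1}. q + 1)"
    using card_Invol_pairs_le by (intro add_mono sum_mono) (auto simp: n_def q_def)
  also have "\<dots> = n + q * (q + 1)" using card_S by (simp add: card_Diff_singleton q_def)
  finally have le: "n * w \<le> n + q * (q + 1)" .
  have "w < 3"
  proof (rule ccontr)
    assume "\<not> w < 3"
    then have "n * 3 \<le> n * w" by (intro mult_le_mono) auto
    then have "2 * n \<le> q * (q + 1)" using le by linarith
    then have "2 * (q^2 - 1) \<le> q^2 + q" using n by (simp add: power2_eq_square)
    then have "q^2 \<le> q + 2" using \<open>q^2 \<ge> 9\<close> by linarith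
    moreover have "3 * q \<le> q^2" using q by (simp add: power2_eq_square)
    ultimately show False using q by linarith
  qed
  moreover have "odd w" using odd_fibre[OF t0] by (simp add: w_def)
  ultimately have w1: "w = 1" by (cases "w = 2") (auto simp: less_Suc_eq numeral_3_eq_3)
  \<comment> \<open>With one involution per coset, the at least \<open>q^2 - 1\<close> involutions
    need distinct cosets different from \<open>S\<close>, but only \<open>q (q - 1) - 1\<close> are
    available.\<close>
  have "inj_on sb Invol"
  proof (rule inj_onI)
    fix x y assume xy: "x \<in> Invol" "y \<in> Invol" "sb x = sb y"
    have "card {t' \<in> Invol. sb t' = sb y} = 1" using card_fibre_eq w w1 xy by simp
    then obtain z where "{t' \<in> Invol. sb t' = sb y} = {z}" by (auto simp: card_1_singleton_iff)
    moreover have "x \<in> {t' \<in> Invol. sb t' = sb y}" "y \<in> {t' \<in> Invol. sb t' = sb y}" using xy by auto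
    ultimately show "x = y" by auto
  qed
  moreover have "sb ` Invol \<subseteq> sb ` G - {sb (mat 1)}" using Invol_G sb_Invol_neq by blast
  ultimately have "n \<le> card (sb ` G - {sb (mat 1)})" unfolding n_def by (intro card_inj_on_le) auto
  also have "\<dots> = q * (q - 1) - 1" using card_cosets_S by (simp add: card_Diff_singleton q_def)
  finally have "q^2 - 1 \<le> q * (q - 1) - 1" using n by linarith
  moreover have "q * (q - 1) + q = q^2" using q by (simp add: power2_eq_square algebra_simps)
  ultimately show False using q \<open>q^2 \<ge> 9\<close> by linarith
qed

end

theorem mainTheorem9:
  fixes p e :: nat
    and S :: "('a::{field,finite}^2^2) set"
    and \<D> :: "('a^2^2) set set"
    and f :: "'a upoint \<Rightarrow> 'a upoint"
  assumes "prime p" and "CARD('a) = p ^ e" and "CARD('a) \<ge> 3"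
    and "affine_SL2_unital p S \<D>"
    and "incidence_automorphism (flat_points p) (flat_blocks p S \<D>) f"
  shows "f ` block_at_infinity p = block_at_infinity p"
proof (rule ccontr)
  assume moved: "f ` block_at_infinity p \<noteq> block_at_infinity p"
  interpret flat_unital p e S \<D> by unfold_locales (use assms in auto)
  \<comment> \<open>Nothing is known about \<open>f\<close> outside \<open>flat_points p\<close>,
    where \<open>auts\<close> demands the identity.\<close>
  define g where "g x = (if x \<in> flat_points p then f x else x)" for x
  have bij: "bij_betw f (flat_points p) (flat_points p)" "bij_betw ((`) f) blocks blocks"
    using assms(5) by (auto simp: incidence_automorphism_def)
  have im: "g ` X = f ` X" if "X \<in> blocks" for X
    using blocks_subset[OF that] by (intro image_cong) (auto simp: g_def)
  have "bij_betw g (flat_points p) (flat_points p)"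
    using bij(1) by (subst bij_betw_cong[where g = f]) (auto simp: g_def)
  then have "g permutes flat_points p" by (rule bij_imp_permutes) (simp add: g_def)
  moreover have "g ` X \<in> blocks" if "X \<in> blocks" for X
    using bij(2) that by (simp add: im bij_betw_apply)
  ultimately have "g \<in> auts" by (simp add: auts_def)
  moreover have "Inft \<in> blocks" by (simp add: flat_blocks_iff)
  then have "g ` Inft \<noteq> Inft" using moved im by simp
  ultimately interpret moved_flat_unital p e S \<D> g by unfold_locales
  show False by (rule no_moved_flat_unital)
qed

end
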